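(* Let $I=[0,1]$, $n\ge 1$, $\mathcal{A}:=\mathcal{M}(I)$, $\Phi(\mu)=\mathbb{E}_{t\sim\mu}[t]$, $\mathcal{D}=I$, and let $\Psi:\mathcal{M}(I)\to\mathbb{R}^n$, $\Psi(\mu)=\bigl(\mathbb{E}_{t\sim\mu}[t^i]\bigr)_{i=1,\dots,n}$, be the map to the truncated Hausdorff moments. Let $\mathbb{Q}$ be the uniform Borel measure (Lebesgue measure) on $\mathbb{R}^n$ restricted to the Hausdorff moment space $M^n:=\Psi(\mathcal{M}(I))$ and normalized to be a probability measure. Let $\mathfrak{Q}$ be a set of Borel probability measures on $\mathbb{R}^n$ with $\mathbb{Q}\in\mathfrak{Q}$, and let $\mathfrak{D}$ be a set of data maps $\mathcal{M}(I)\to\mathcal{M}(I)$ with $\mathbb{D}^1\in\mathfrak{D}$, where $\mathbb{D}^1\mu:=\mu$. Let $d\in I$ be a data point and let $B_\delta$ denote the open ball in $I$ of radius $\delta$ about $d$. Then for every $\delta>0$, $$1-4e\Bigl(\frac{2n\delta}{e}\Bigr)^{\frac{1}{2n+1}}\ \le\ \mathcal{U}\bigl(\Psi^{-1}(\mathfrak{Q})\odot_{B_\delta}\mathfrak{D}\bigr)\ \le\ 1 .$$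
   Context: $\mathcal{M}(\mathcal{Y})$ denotes the Borel probability measures on $\mathcal{Y}$; $\mathcal{M}(I)$ carries the weak star topology. A data map is a map $\mathbb{D}:\mathcal{M}(I)\to\mathcal{M}(I)$ such that $\mu\mapsto\mathbb{D}(\mu)[B]$ is measurable for Borel $B$. Elements $\pi\in\mathcal{M}(\mathcal{M}(I))$ are called priors, and $\Psi^{-1}(\mathfrak{Q}):=\{\pi\in\mathcal{M}(\mathcal{M}(I)):\Psi_*\pi\in\mathfrak{Q}\}$ with $\Psi_*\pi$ the push-forward. For a prior $\pi$, data map $\mathbb{D}$ and open $B\subset I$, put $(\pi\cdot\mathbb{D})[B]:=\mathbb{E}_{\mu\sim\pi}[\mathbb{D}(\mu)[B]]$, and, when this is positive, $$\mathbb{E}_{\pi\odot\mathbb{D}}[\Phi\mid B]:=\frac{\mathbb{E}_{\mu\sim\pi}\bigl[\Phi(\mu)\,\mathbb{D}(\mu)[B]\bigr]}{\mathbb{E}_{\mu\sim\pi}\bigl[\mathbb{D}(\mu)[B]\bigr]}.$$ For a set $\Pi$ of priors, $\mathcal{U}(\Pi\odot_B\mathfrak{D}):=\sup\{\mathbb{E}_{\pi\odot\mathbb{D}}[\Phi\mid B]:\ \pi\in\Pi,\ \mathbb{D}\in\mathfrak{D},\ (\pi\cdot\mathbb{D})[B]>0\}$. *)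

theory Defs
  imports "HOL-Probability.Probability"
begin

text \<open>\<open>\<M>(\<Y>)\<close>: the probability measures on the measurable space \<open>N\<close>. Only the carrier of the
  library's \<open>prob_algebra\<close> is used here; the measurable structure that \<open>\<M>(\<M>(I))\<close>
  refers to is the Borel one of the weak star topology below.\<close>

abbreviation prob_measures :: "'a measure \<Rightarrow> 'a measure set" where
  "prob_measures N \<equiv> space (prob_algebra N)"

definition borel_of :: "'a topology \<Rightarrow> 'a measure" where
  "borel_of T = sigma (topspace T) {U. openin T U}"

definition unit_borel :: "real measure" where
  "unit_borel = restrict_space borel {0..1}"

text \<open>The coarsest topology on \<open>\<M>(I)\<close> making \<open>\<mu> \<mapsto> \<integral>f d\<mu>\<close> continuous for every
  continuous \<open>f\<close> on \<open>I\<close>.\<close>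

definition weak_star :: "real measure topology" where
  "weak_star = topology_generated_by
     {{\<mu> \<in> prob_measures unit_borel. (\<integral>t. f t \<partial>\<mu>) \<in> U} | f U.
        continuous_on {0..1} (f :: real \<Rightarrow> real) \<and> open (U :: real set)}"

lemma topspace_weak_star: "topspace weak_star = prob_measures unit_borel"
proof
  show "topspace weak_star \<subseteq> prob_measures unit_borel"
    unfolding weak_star_def topology_generated_by_topspace by blast
  have "continuous_on {0..1} (\<lambda>_::real. 0::real)" by simp
  then have "{\<mu> \<in> prob_measures unit_borel. (\<integral>t. (\<lambda>_. 0) t \<partial>\<mu>) \<in> (UNIV :: real set)}
      \<subseteq> topspace weak_star"
    unfolding weak_star_def topology_generated_by_topspace using open_UNIV by blast
  then show "prob_measures unit_borel \<subseteq> topspace weak_star" by simp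
qed

abbreviation priors :: "real measure measure set" where
  "priors \<equiv> prob_measures (borel_of weak_star)"

text \<open>Data maps are extensional functions, i.e. they carry no information outside \<open>\<M>(I)\<close>.\<close>

definition data_maps :: "(real measure \<Rightarrow> real measure) set" where
  "data_maps = {D \<in> prob_measures unit_borel \<rightarrow>\<^sub>E prob_measures unit_borel.
     \<forall>B \<in> sets unit_borel. (\<lambda>\<mu>. measure (D \<mu>) B) \<in> borel_measurable (borel_of weak_star)}"

definition id_data_map :: "real measure \<Rightarrow> real measure" where
  "id_data_map = (\<lambda>\<mu>\<in>prob_measures unit_borel. \<mu>)"

definition data_prob :: "real measure measure \<Rightarrow> (real measure \<Rightarrow> real measure) \<Rightarrow> real set \<Rightarrow> real"
  where "data_prob \<pi> D B = (\<integral>\<mu>. measure (D \<mu>) B \<partial>\<pi>)"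

definition post_expectation ::
    "real measure measure \<Rightarrow> (real measure \<Rightarrow> real measure) \<Rightarrow> (real measure \<Rightarrow> real)
      \<Rightarrow> real set \<Rightarrow> real" where
  "post_expectation \<pi> D \<Phi> B =
     (\<integral>\<mu>. \<Phi> \<mu> * measure (D \<mu>) B \<partial>\<pi>) / data_prob \<pi> D B"

text \<open>\<open>\<U>(\<Pi> \<odot>\<^sub>B \<DD>)\<close> for a set \<open>PP\<close> of priors (\<open>\<Pi>\<close>) and a set \<open>DD\<close> of data maps. The supremum
  is taken in the extended reals, so that the supremum of the empty set is \<open>-\<infinity>\<close>.\<close>

definition upper_value ::
    "(real measure \<Rightarrow> real) \<Rightarrow> real measure measure set \<Rightarrow> real set
      \<Rightarrow> (real measure \<Rightarrow> real measure) set \<Rightarrow> ereal" where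
  "upper_value \<Phi> PP B DD =
     Sup {ereal (post_expectation \<pi> D \<Phi> B) | \<pi> D. \<pi> \<in> PP \<and> D \<in> DD \<and> data_prob \<pi> D B > 0}"

text \<open>\<open>\<real>\<^sup>n\<close> consists of the extensional functions on \<open>{1..n}\<close>. Its Borel sets form the product
  sigma-algebra, and Lebesgue measure is the product of the one-dimensional ones.\<close>

definition Rn_borel :: "nat \<Rightarrow> (nat \<Rightarrow> real) measure" where
  "Rn_borel n = PiM {1..n} (\<lambda>_. borel)"

definition Rn_lborel :: "nat \<Rightarrow> (nat \<Rightarrow> real) measure" where
  "Rn_lborel n = PiM {1..n} (\<lambda>_. lborel)"

definition moment_map :: "nat \<Rightarrow> real measure \<Rightarrow> (nat \<Rightarrow> real)" where
  "moment_map n \<mu> = (\<lambda>i\<in>{1..n}. \<integral>t. t ^ i \<partial>\<mu>)"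

definition moment_space :: "nat \<Rightarrow> (nat \<Rightarrow> real) set" where
  "moment_space n = moment_map n ` prob_measures unit_borel"

definition uniform_moment_measure :: "nat \<Rightarrow> (nat \<Rightarrow> real) measure" where
  "uniform_moment_measure n = uniform_measure (Rn_lborel n) (moment_space n)"

definition moment_priors :: "nat \<Rightarrow> (nat \<Rightarrow> real) measure set \<Rightarrow> real measure measure set" where
  "moment_priors n QQ = {\<pi> \<in> priors. distr \<pi> (Rn_borel n) (moment_map n) \<in> QQ}"

definition mean :: "real measure \<Rightarrow> real" where
  "mean \<mu> = (\<integral>t. t \<partial>\<mu>)"

end

theory Submission
  imports Defs "HOL-Computational_Algebra.Polynomial"
begin

text \<open>Write \<open>\<gamma>(x) = (x, x^2, ..., x^n)\<close> and \<open>M\<close> for the moment space, the convex hull of the curve \<open>\<gamma>\<close>.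
The mean of a measure is the first coordinate of its moment vector. Hence a measurable choice
\<open>q \<mapsto> F q\<close> of representing measures turns the uniform distribution of \<open>q\<close> on \<open>M\<close> into an admissible
prior, and its posterior mean given \<open>B\<close>, under the identity data map, is the average of the first
coordinate of \<open>q\<close> with weights \<open>F q B\<close>. The posterior mean is close to \<open>1\<close> as soon as \<open>F q\<close> charges
\<open>B\<close> noticeably for some \<open>q\<close> with first coordinate close to \<open>1\<close>, and not at all for most other \<open>q\<close>.

Both requirements are met by homothetic copies of \<open>M\<close>, whose volumes are known exactly. On the copy
\<open>(1 - s) \<gamma>(1) + s w \<gamma>(d) + s (1 - w) M\<close>, a fraction \<open>(s (1 - w))^n\<close> of \<open>M\<close>, there are representing
measures with mean at least \<open>1 - s\<close> and mass at least \<open>s w\<close> at \<open>d\<close>. On the other hand the moment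
vectors that have a representing measure off \<open>B\<close> contain a copy of \<open>M\<close> of ratio \<open>1 / (1 + \<eta>)\<close> with
\<open>\<eta> = O(\<delta>)\<close> (\<open>moment_hull_avoiding_ball\<close>): Lagrange interpolation at \<open>n + 1\<close> nodes off \<open>B\<close>, one of
them an end point of \<open>B\<close>, writes \<open>\<gamma>(x)\<close> with \<open>x \<in> B\<close> as an affine combination of the nodes with
negative coefficients of size \<open>O(\<delta>)\<close>, and adding a fixed positive combination of total weight \<open>\<eta>\<close>
makes all coefficients nonnegative. So at most the fraction \<open>1 - (1 + \<eta>)^-n \<le> n \<eta>\<close> of the moment
vectors needs mass in \<open>B\<close>, and the posterior mean is at least
\<open>1 - s - n \<eta> / (s w (s (1 - w))^n)\<close> (\<open>posterior_near_one\<close>). The choice \<open>s = \<epsilon> / 2\<close>,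
\<open>w = 1 / (n + 1)\<close>, where \<open>\<epsilon>\<close> is the error term of the theorem, makes this at least \<open>1 - \<epsilon>\<close>
(\<open>radius_estimates\<close>).

The choice of \<open>F\<close> is measurable because almost all of \<open>M\<close> is covered by countably many simplices
with vertices \<open>\<gamma>(x)\<close>, \<open>x\<close> rational (\<open>emeasure_moment_space_le_hull\<close>). On each simplex the weights
of the vertices are affine functions of \<open>q\<close>, and a finite combination of point masses depends
continuously on its weights and positions in the weak star topology.\<close>

section \<open>Lagrange interpolation and representing weights\<close>

text \<open>The total mass is included as the moment of order \<open>0\<close>, so that affine combinations of
moment vectors become linear ones.\<close>

definition moment :: "(nat \<Rightarrow> real) \<Rightarrow> nat \<Rightarrow> real" where
  "moment q k = (if k = 0 then 1 else q k)"

text \<open>The Riesz functional of \<open>q\<close>: integration of polynomials of degree at most \<open>n\<close> against any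
measure with moments \<open>q\<close>.\<close>

definition riesz :: "nat \<Rightarrow> (nat \<Rightarrow> real) \<Rightarrow> real poly \<Rightarrow> real" where
  "riesz n q p = (\<Sum>k\<le>n. coeff p k * moment q k)"

definition lagrange :: "real set \<Rightarrow> real \<Rightarrow> real poly" where
  "lagrange X x = (\<Prod>y\<in>X - {x}. smult (1 / (x - y)) [:- y, 1:])"

lemma poly_lagrange: "poly (lagrange X x) t = (\<Prod>y\<in>X - {x}. (t - y) / (x - y))"
  by (simp add: lagrange_def poly_prod diff_divide_distrib)

lemma degree_lagrange:
  assumes "finite X" "card X = Suc n" "x \<in> X"
  shows "degree (lagrange X x) \<le> n"
proof -
  have "degree (lagrange X x) \<le> (\<Sum>y\<in>X - {x}. degree (smult (1 / (x - y)) [:- y, 1:]))"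
    unfolding lagrange_def using assms(1) by (intro degree_prod_sum_le[THEN order_trans]) auto
  also have "\<dots> \<le> (\<Sum>y\<in>X - {x}. 1)"
    by (intro sum_mono order_trans[OF degree_smult_le]) simp
  finally show ?thesis using assms by simp
qed

lemma poly_lagrange_node:
  assumes "finite X" "x \<in> X" "y \<in> X"
  shows "poly (lagrange X x) y = (if y = x then 1 else 0)"
  using assms by (auto simp: poly_lagrange intro!: prod.neutral)

lemma lagrange_interpolation:
  assumes "finite X" "card X = Suc n" "degree p \<le> n"
  shows "p = (\<Sum>x\<in>X. smult (poly p x) (lagrange X x))"
proof (rule poly_eqI_degree)
  show "poly p y = poly (\<Sum>x\<in>X. smult (poly p x) (lagrange X x)) y" if "y \<in> X" for y
    using that assms(1) by (simp add: poly_sum poly_lagrange_node if_distrib[of "\<lambda>z. _ * z"] cong: if_cong)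
  have "degree (\<Sum>x\<in>X. smult (poly p x) (lagrange X x)) \<le> n"
    using degree_lagrange[OF assms(1,2)] assms(1)
    by (intro degree_sum_le order_trans[OF degree_smult_le]) auto
  then show "degree (\<Sum>x\<in>X. smult (poly p x) (lagrange X x)) < card X" "degree p < card X"
    using assms by auto
qed

lemma riesz_sum: "riesz n q (\<Sum>i\<in>J. smult (a i) (p i)) = (\<Sum>i\<in>J. a i * riesz n q (p i))"
  by (induction J rule: infinite_finite_induct)
    (auto simp: riesz_def algebra_simps sum.distrib sum_distrib_left)

lemma riesz_monom: "k \<le> n \<Longrightarrow> riesz n q (monom 1 k) = moment q k"
  by (simp add: riesz_def if_distrib[of "\<lambda>z. z * _"] cong: if_cong)

lemma riesz_of_atoms:
  assumes "\<And>k. k \<le> n \<Longrightarrow> moment q k = (\<Sum>j\<in>J. c j * y j ^ k)" "degree p \<le> n"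
  shows "riesz n q p = (\<Sum>j\<in>J. c j * poly p (y j))"
proof -
  have "riesz n q p = (\<Sum>k\<le>n. \<Sum>j\<in>J. c j * (coeff p k * y j ^ k))"
    unfolding riesz_def using assms(1) by (auto simp: sum_distrib_left mult_ac intro!: sum.cong)
  also have "\<dots> = (\<Sum>j\<in>J. c j * (\<Sum>k\<le>n. coeff p k * y j ^ k))"
    by (subst sum.swap) (simp add: sum_distrib_left)
  also have "\<dots> = (\<Sum>j\<in>J. c j * poly p (y j))"
    using assms(2) unfolding poly_altdef
    by (intro sum.cong refl arg_cong2[where f = "(*)"] sum.mono_neutral_right)
      (auto simp: coeff_eq_0)
  finally show ?thesis .
qed

lemma monom_lagrange:
  assumes "finite X" "card X = Suc n" "k \<le> n"
  shows "monom 1 k = (\<Sum>x\<in>X. smult (x ^ k) (lagrange X x))"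
  using lagrange_interpolation[OF assms(1,2), of "monom 1 k"] assms(3)
  by (simp add: degree_monom_eq poly_monom)

text \<open>The weights with which \<open>q\<close> is a combination of the \<open>n + 1\<close> points \<open>\<gamma>(x)\<close>, \<open>x \<in> X\<close>, are the
values of the Riesz functional at the Lagrange basis. They are affine in \<open>q\<close>, which is what makes
the choice of representing measures measurable below.\<close>

lemma moments_lagrange:
  assumes "finite X" "card X = Suc n" "k \<le> n"
  shows "moment q k = (\<Sum>x\<in>X. riesz n q (lagrange X x) * x ^ k)"
proof -
  have "riesz n q (monom 1 k) = riesz n q (\<Sum>x\<in>X. smult (x ^ k) (lagrange X x))"
    by (simp only: monom_lagrange[OF assms])
  then show ?thesis using assms(3) by (simp add: riesz_monom riesz_sum mult_ac)
qed

lemma power_lagrange: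
  assumes "finite X" "card X = Suc n" "k \<le> n"
  shows "t ^ k = (\<Sum>x\<in>X. poly (lagrange X x) t * x ^ k)"
proof -
  have "poly (monom 1 k) t = poly (\<Sum>x\<in>X. smult (x ^ k) (lagrange X x)) t"
    by (simp only: monom_lagrange[OF assms])
  then show ?thesis by (simp add: poly_monom poly_sum mult_ac)
qed

section \<open>Simplices spanned by points of the moment curve\<close>

definition represents :: "nat \<Rightarrow> (nat \<Rightarrow> real) \<Rightarrow> real set \<Rightarrow> (real \<Rightarrow> real) \<Rightarrow> bool" where
  "represents n q X c \<longleftrightarrow> finite X \<and> (\<forall>x\<in>X. 0 \<le> c x) \<and> (\<forall>k\<le>n. moment q k = (\<Sum>x\<in>X. c x * x ^ k))"

definition moment_hull :: "nat \<Rightarrow> real set \<Rightarrow> (nat \<Rightarrow> real) set" where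
  "moment_hull n D = {q \<in> space (Rn_borel n). \<exists>X c. X \<subseteq> D \<and> represents n q X c}"

definition moment_simplex :: "nat \<Rightarrow> real set \<Rightarrow> (nat \<Rightarrow> real) set" where
  "moment_simplex n X = {q \<in> space (Rn_borel n). \<forall>x\<in>X. 0 \<le> riesz n q (lagrange X x)}"

definition simplex_union :: "nat \<Rightarrow> real set \<Rightarrow> (nat \<Rightarrow> real) set" where
  "simplex_union n D = (\<Union>X\<in>{X. finite X \<and> X \<subseteq> D \<and> card X = Suc n}. moment_simplex n X)"

text \<open>Caratheodory's reduction step. Interpolating at \<open>n + 1\<close> nodes of \<open>X\<close> gives a linear
relation between the vectors \<open>(1, \<gamma>(x))\<close>; a multiple of it is subtracted until some weight vanishes.\<close>

lemma represents_shrink: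
  assumes "represents n q X c" "card X > Suc n"
  obtains Y e where "Y \<subset> X" "represents n q Y e"
proof -
  have X: "finite X" and c: "\<And>x. x \<in> X \<Longrightarrow> 0 \<le> c x"
    and q: "\<And>k. k \<le> n \<Longrightarrow> moment q k = (\<Sum>x\<in>X. c x * x ^ k)"
    using assms(1) by (auto simp: represents_def)
  obtain Z where Z: "Z \<subseteq> X" "card Z = Suc n" "finite Z"
    using obtain_subset_with_card_n[of "Suc n" X] assms(2) by auto
  have "Z \<noteq> X" using Z assms(2) by auto
  then obtain z where z: "z \<in> X" "z \<notin> Z" using Z by auto
  define v where "v = (\<lambda>x. if x \<in> Z then - poly (lagrange Z x) z else if x = z then 1 else 0)"
  have v: "(\<Sum>x\<in>X. v x * x ^ k) = 0" if "k \<le> n" for k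
  proof -
    have "(\<Sum>x\<in>X. v x * x ^ k) = (\<Sum>x\<in>insert z Z. v x * x ^ k)"
      using X Z z by (intro sum.mono_neutral_right) (auto simp: v_def)
    also have "\<dots> = z ^ k - (\<Sum>x\<in>Z. poly (lagrange Z x) z * x ^ k)"
      using Z z by (simp add: v_def sum_negf)
    finally show ?thesis using power_lagrange[OF Z(3,2) that, of z] by simp
  qed
  define P where "P = {x \<in> X. v x > 0}"
  have P: "finite P" "z \<in> P" using X z by (auto simp: P_def v_def)
  \<comment> \<open>the largest multiple of \<open>v\<close> that can be subtracted without creating a negative weight\<close>
  define t where "t = Min ((\<lambda>x. c x / v x) ` P)"
  have "t \<in> (\<lambda>x. c x / v x) ` P" unfolding t_def using P by (intro Min_in) auto
  then obtain y where y: "y \<in> P" "t = c y / v y" by auto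
  have tle: "t \<le> c x / v x" if "x \<in> P" for x unfolding t_def using P that by auto
  have t0: "0 \<le> t" using y c by (auto simp: P_def)
  define e where "e = (\<lambda>x. c x - t * v x)"
  have e0: "0 \<le> e x" if "x \<in> X" for x
  proof (cases "v x > 0")
    case True
    then show ?thesis using tle[of x] that by (simp add: e_def P_def field_simps)
  next
    case False
    then have "t * v x \<le> 0" using t0 by (simp add: mult_nonneg_nonpos)
    then show ?thesis using c[OF that] by (simp add: e_def)
  qed
  have ey: "e y = 0" "y \<in> X" using y by (auto simp: e_def P_def)
  have "moment q k = (\<Sum>x\<in>X - {y}. e x * x ^ k)" if "k \<le> n" for k
  proof -
    have "(\<Sum>x\<in>X. e x * x ^ k) = (\<Sum>x\<in>X. c x * x ^ k) - t * (\<Sum>x\<in>X. v x * x ^ k)"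
      by (simp add: e_def algebra_simps sum_subtractf sum_distrib_left)
    then have "moment q k = (\<Sum>x\<in>X. e x * x ^ k)" using q v that by simp
    also have "\<dots> = (\<Sum>x\<in>X - {y}. e x * x ^ k)" using X ey by (simp add: sum.remove)
    finally show ?thesis .
  qed
  then have "represents n q (X - {y}) e" using X e0 by (auto simp: represents_def)
  moreover have "X - {y} \<subset> X" using ey by auto
  ultimately show ?thesis by (rule that[rotated])
qed

lemma caratheodory_moments:
  assumes "represents n q X c"
  obtains Y e where "Y \<subseteq> X" "card Y \<le> Suc n" "represents n q Y e"
proof -
  have "\<exists>Y e. Y \<subseteq> X \<and> card Y \<le> Suc n \<and> represents n q Y e"
    using assms
  proof (induction "card X" arbitrary: X c rule: less_induct)
    case less
    show ?case
    proof (cases "card X \<le> Suc n")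
      case False
      then obtain Y e where Y: "Y \<subset> X" "represents n q Y e"
        using represents_shrink[OF less.prems] by auto
      have "card Y < card X" using Y less.prems by (auto simp: represents_def psubset_card_mono)
      then obtain Z g where "Z \<subseteq> Y" "card Z \<le> Suc n" "represents n q Z g"
        using less.hyps Y(2) by metis
      then show ?thesis using Y(1) by (meson psubset_imp_subset subset_trans)
    qed (use less.prems in auto)
  qed
  then show ?thesis using that by blast
qed

text \<open>A representation by fewer than \<open>n + 1\<close> points is padded with further points of \<open>D\<close> of
weight zero.\<close>

lemma moment_hull_subset_simplices:
  assumes "infinite D"
  shows "moment_hull n D \<subseteq> simplex_union n D"
proof
  fix q assume q: "q \<in> moment_hull n D"
  then obtain X0 c0 where "X0 \<subseteq> D" "represents n q X0 c0" by (auto simp: moment_hull_def)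
  then obtain X c where X: "X \<subseteq> D" "card X \<le> Suc n" "represents n q X c"
    using caratheodory_moments by (metis subset_trans)
  then have fin: "finite X" by (simp add: represents_def)
  obtain Y where Y: "finite Y" "card Y = Suc n - card X" "Y \<subseteq> D - X"
    using infinite_arbitrarily_large[of "D - X"] assms fin by auto
  define Z where "Z = X \<union> Y"
  have Z: "finite Z" "card Z = Suc n" "Z \<subseteq> D"
    using X Y fin card_Un_disjoint[of X Y] by (auto simp: Z_def)
  define e where "e = (\<lambda>x. if x \<in> X then c x else 0)"
  have mom: "moment q k = (\<Sum>x\<in>Z. e x * x ^ k)" if "k \<le> n" for k
  proof -
    have "(\<Sum>x\<in>Z. e x * x ^ k) = (\<Sum>x\<in>X. e x * x ^ k)"
      using Z by (intro sum.mono_neutral_right) (auto simp: Z_def e_def)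
    then show ?thesis using X(3) that by (simp add: e_def represents_def)
  qed
  have "0 \<le> riesz n q (lagrange Z x)" if "x \<in> Z" for x
  proof -
    have "riesz n q (lagrange Z x) = (\<Sum>y\<in>Z. e y * poly (lagrange Z x) y)"
      using mom degree_lagrange[OF Z(1,2) that] by (intro riesz_of_atoms) auto
    also have "\<dots> = e x" using Z that
      by (simp add: poly_lagrange_node if_distrib[of "\<lambda>z. _ * z"] cong: if_cong)
    finally show ?thesis using X by (auto simp: e_def represents_def)
  qed
  then have "q \<in> moment_simplex n Z" using q by (auto simp: moment_simplex_def moment_hull_def)
  then show "q \<in> simplex_union n D" using Z by (auto simp: simplex_union_def)
qed

lemma simplex_union_subset_moment_hull: "simplex_union n D \<subseteq> moment_hull n D"
proof
  fix q assume "q \<in> simplex_union n D"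
  then obtain X where X: "finite X" "X \<subseteq> D" "card X = Suc n" and q: "q \<in> moment_simplex n X"
    by (auto simp: simplex_union_def)
  have "represents n q X (\<lambda>x. riesz n q (lagrange X x))"
    using q X moments_lagrange[OF X(1,3)] by (auto simp: represents_def moment_simplex_def)
  then show "q \<in> moment_hull n D" using q X by (auto simp: moment_hull_def moment_simplex_def)
qed

lemma moment_hull_eq: "infinite D \<Longrightarrow> moment_hull n D = simplex_union n D"
  using moment_hull_subset_simplices simplex_union_subset_moment_hull by blast

lemma measurable_riesz [measurable]: "(\<lambda>q. riesz n q p) \<in> borel_measurable (Rn_borel n)"
  unfolding riesz_def
proof (intro borel_measurable_sum borel_measurable_times borel_measurable_const)
  fix k assume "k \<in> {..n}"
  then show "(\<lambda>q. moment q k) \<in> borel_measurable (Rn_borel n)"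
    by (cases "k = 0") (auto simp: moment_def Rn_borel_def intro!: measurable_component_singleton)
qed

lemma sets_moment_simplex [measurable]: "finite X \<Longrightarrow> moment_simplex n X \<in> sets (Rn_borel n)"
  unfolding moment_simplex_def by measurable

lemma sets_simplex_union:
  assumes "countable D"
  shows "simplex_union n D \<in> sets (Rn_borel n)"
proof -
  have "countable {X. finite X \<and> X \<subseteq> D \<and> card X = Suc n}"
    using countable_Collect_finite_subset[OF assms] by (rule countable_subset[rotated]) auto
  then show ?thesis unfolding simplex_union_def by (intro sets.countable_UN') auto
qed

section \<open>Finite combinations of point masses\<close>

text \<open>The weights and the positions are taken as one argument because the map is continuous in both
jointly.\<close>

definition atomic :: "nat \<Rightarrow> (nat \<Rightarrow> real) \<times> (nat \<Rightarrow> real) \<Rightarrow> real measure" where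
  "atomic N z = distr (point_measure {..<N} (\<lambda>i. ennreal (fst z i))) unit_borel (snd z)"

definition atom_data :: "nat \<Rightarrow> ((nat \<Rightarrow> real) \<times> (nat \<Rightarrow> real)) set" where
  "atom_data N = {z. (\<forall>i<N. 0 \<le> fst z i \<and> snd z i \<in> {0..1}) \<and> (\<Sum>i<N. fst z i) = 1}"

lemma space_unit_borel [simp]: "space unit_borel = {0..1}"
  by (simp add: unit_borel_def space_restrict_space)

lemma borel_measurable_unit_borel:
  fixes f :: "real \<Rightarrow> real"
  shows "continuous_on {0..1} f \<Longrightarrow> f \<in> borel_measurable unit_borel"
  unfolding unit_borel_def by (rule borel_measurable_continuous_on_restrict)

lemma prob_measures_unit_borelD:
  assumes "\<mu> \<in> prob_measures unit_borel"
  shows "prob_space \<mu>" "sets \<mu> = sets unit_borel" "space \<mu> = {0..1}"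
  using assms sets_eq_imp_space_eq[of \<mu> unit_borel] by (auto simp: space_prob_algebra)

lemma measurable_atom_positions:
  "z \<in> atom_data N \<Longrightarrow> snd z \<in> measurable (point_measure {..<N} f) unit_borel"
  by (auto simp: atom_data_def measurable_def sets_point_measure space_point_measure)

lemma integral_atomic:
  fixes f :: "real \<Rightarrow> real"
  assumes "z \<in> atom_data N" "f \<in> borel_measurable unit_borel"
  shows "(\<integral>t. f t \<partial>atomic N z) = (\<Sum>i<N. fst z i * f (snd z i))"
  unfolding atomic_def integral_distr[OF measurable_atom_positions[OF assms(1)] assms(2)]
  using assms(1) by (intro lebesgue_integral_point_measure_finite[THEN trans])
    (auto simp: atom_data_def)

lemma atomic_in_prob_measures:
  assumes "z \<in> atom_data N"
  shows "atomic N z \<in> prob_measures unit_borel"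
proof -
  have "emeasure (point_measure {..<N} (\<lambda>i. ennreal (fst z i))) {..<N} = 1"
    using assms sum_ennreal[of "{..<N}" "fst z"]
    by (simp add: emeasure_point_measure_finite atom_data_def)
  then have "prob_space (point_measure {..<N} (\<lambda>i. ennreal (fst z i)))"
    by (intro prob_spaceI) (simp add: space_point_measure)
  then show ?thesis unfolding atomic_def space_prob_algebra
    using measurable_atom_positions[OF assms] by (auto intro: prob_space.prob_space_distr)
qed

lemma measure_atomic:
  assumes "z \<in> atom_data N" "A \<in> sets unit_borel"
  shows "measure (atomic N z) A = (\<Sum>i<N. fst z i * indicator A (snd z i))"
proof -
  interpret prob_space "atomic N z"
    using atomic_in_prob_measures[OF assms(1)] by (rule prob_measures_unit_borelD)
  have "sets (atomic N z) = sets unit_borel" "space (atomic N z) = {0..1}"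
    using prob_measures_unit_borelD[OF atomic_in_prob_measures[OF assms(1)]] by auto
  moreover have "A \<subseteq> {0..1}" using sets.sets_into_space[OF assms(2)] by simp
  ultimately have "measure (atomic N z) A = (\<integral>t. indicator A t \<partial>atomic N z)"
    by (simp add: Int_absorb2)
  also have "\<dots> = (\<Sum>i<N. fst z i * indicator A (snd z i))"
    using assms by (intro integral_atomic) auto
  finally show ?thesis .
qed

text \<open>It suffices to test with continuous functions \<open>f\<close>, for which the integral
\<open>\<Sum>i. c i * f (x i)\<close> is visibly continuous in \<open>(c, x)\<close>.\<close>

lemma continuous_map_atomic: "continuous_map (top_of_set (atom_data N)) weak_star (atomic N)"
  unfolding weak_star_def continuous_on_generated_topo_iff
proof (intro conjI allI impI)
  fix V :: "real measure set"
  assume "V \<in> {{\<mu> \<in> prob_measures unit_borel. (\<integral>t. f t \<partial>\<mu>) \<in> U} | f U.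
        continuous_on {0..1} (f :: real \<Rightarrow> real) \<and> open (U :: real set)}"
  then obtain f :: "real \<Rightarrow> real" and U where f: "continuous_on {0..1} f" and U: "open U"
    and V: "V = {\<mu> \<in> prob_measures unit_borel. (\<integral>t. f t \<partial>\<mu>) \<in> U}" by auto
  define g where "g = (\<lambda>z :: (nat \<Rightarrow> real) \<times> (nat \<Rightarrow> real). \<Sum>i<N. fst z i * f (snd z i))"
  have coord: "continuous_on (atom_data N) (\<lambda>z. fst z i)" "continuous_on (atom_data N) (\<lambda>z. snd z i)" for i
    by (rule continuous_on_product_then_coordinatewise, rule continuous_on_fst, rule continuous_on_id)
      (rule continuous_on_product_then_coordinatewise, rule continuous_on_snd, rule continuous_on_id)
  have "continuous_on (atom_data N) g"
    unfolding g_def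
    by (intro continuous_on_sum continuous_on_mult coord continuous_on_compose2[OF f])
      (auto simp: atom_data_def)
  moreover have "atomic N -` V \<inter> topspace (top_of_set (atom_data N)) = atom_data N \<inter> g -` U"
    unfolding V using atomic_in_prob_measures integral_atomic[OF _ borel_measurable_unit_borel[OF f]]
    by (auto simp: g_def)
  ultimately show "openin (top_of_set (atom_data N)) (atomic N -` V \<inter> topspace (top_of_set (atom_data N)))"
    using U continuous_openin_preimage_gen by metis
next
  have "prob_measures unit_borel
      \<in> {{\<mu> \<in> prob_measures unit_borel. (\<integral>t. f t \<partial>\<mu>) \<in> U} | f U.
        continuous_on {0..1} (f :: real \<Rightarrow> real) \<and> open (U :: real set)}"
    by (rule CollectI, rule exI[of _ "\<lambda>_. 0"], rule exI[of _ UNIV]) auto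
  then show "atomic N ` topspace (top_of_set (atom_data N))
      \<subseteq> \<Union> {{\<mu> \<in> prob_measures unit_borel. (\<integral>t. f t \<partial>\<mu>) \<in> U} | f U.
        continuous_on {0..1} (f :: real \<Rightarrow> real) \<and> open (U :: real set)}"
    using atomic_in_prob_measures by auto
qed

lemma openin_borel_of: "openin T U \<Longrightarrow> U \<in> sets (borel_of T)"
  unfolding borel_of_def using openin_subset[of T]
  by (subst sets_measure_of) (auto intro: sigma_sets.Basic)

lemma space_borel_of: "space (borel_of T) = topspace T"
  unfolding borel_of_def using openin_subset[of T] by (intro space_measure_of) auto

lemma measurable_borel_of:
  assumes "f \<in> space M \<rightarrow> topspace T"
    and "\<And>U. openin T U \<Longrightarrow> f -` U \<inter> space M \<in> sets M"
  shows "f \<in> measurable M (borel_of T)"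
  unfolding borel_of_def using assms openin_subset[of T]
  by (intro measurable_measure_of) auto

text \<open>An open set of the weak star topology is an arbitrary union of finite intersections of
subbasic sets, so it is not enough that the preimages of subbasic sets are measurable. The
factorisation through the second countable space of weights and positions avoids this problem: the
preimage there is relatively open, hence Borel.\<close>

lemma measurable_atomic:
  assumes c: "c \<in> borel_measurable M" and x: "x \<in> borel_measurable M"
    and valid: "\<And>\<omega>. \<omega> \<in> space M \<Longrightarrow> (c \<omega>, x \<omega>) \<in> atom_data N"
  shows "(\<lambda>\<omega>. atomic N (c \<omega>, x \<omega>)) \<in> measurable M (borel_of weak_star)"
proof (rule measurable_borel_of)
  show "(\<lambda>\<omega>. atomic N (c \<omega>, x \<omega>)) \<in> space M \<rightarrow> topspace weak_star"
    using valid atomic_in_prob_measures by (auto simp: topspace_weak_star)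
  fix U assume "openin weak_star U"
  then have "openin (top_of_set (atom_data N)) {z \<in> topspace (top_of_set (atom_data N)). atomic N z \<in> U}"
    using continuous_map_atomic openin_continuous_map_preimage by blast
  then obtain W where W: "open W" "{z \<in> atom_data N. atomic N z \<in> U} = atom_data N \<inter> W"
    by (auto simp: openin_open)
  have "(\<lambda>\<omega>. atomic N (c \<omega>, x \<omega>)) -` U \<inter> space M = (\<lambda>\<omega>. (c \<omega>, x \<omega>)) -` W \<inter> space M"
    using valid W(2) by (auto 4 4)
  also have "\<dots> \<in> sets M"
    using W(1) borel_measurable_Pair[OF c x] by (intro measurable_sets[of _ M borel]) auto
  finally show "(\<lambda>\<omega>. atomic N (c \<omega>, x \<omega>)) -` U \<inter> space M \<in> sets M" .
qed

lemma measurable_weak_star_integral: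
  fixes f :: "real \<Rightarrow> real"
  assumes "continuous_on {0..1} f"
  shows "(\<lambda>\<mu>. \<integral>t. f t \<partial>\<mu>) \<in> borel_measurable (borel_of weak_star)"
proof (rule borel_measurableI)
  fix U :: "real set" assume "open U"
  have "(\<lambda>\<mu>. \<integral>t. f t \<partial>\<mu>) -` U \<inter> space (borel_of weak_star)
      = {\<mu> \<in> prob_measures unit_borel. (\<integral>t. f t \<partial>\<mu>) \<in> U}"
    by (auto simp: space_borel_of topspace_weak_star)
  moreover have "openin weak_star {\<mu> \<in> prob_measures unit_borel. (\<integral>t. f t \<partial>\<mu>) \<in> U}"
    unfolding weak_star_def using assms \<open>open U\<close> by (intro topology_generated_by_Basis) auto
  ultimately show "(\<lambda>\<mu>. \<integral>t. f t \<partial>\<mu>) -` U \<inter> space (borel_of weak_star) \<in> sets (borel_of weak_star)"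
    by (simp add: openin_borel_of)
qed

lemma measurable_moment_map: "moment_map n \<in> measurable (borel_of weak_star) (Rn_borel n)"
  unfolding moment_map_def Rn_borel_def
  by (intro measurable_restrict measurable_weak_star_integral continuous_intros)

lemma moment_map_in_space: "moment_map n \<mu> \<in> space (Rn_borel n)"
  by (simp add: moment_map_def Rn_borel_def space_PiM PiE_def extensional_def)

lemma moment_moment_map:
  assumes "\<mu> \<in> prob_measures unit_borel" "k \<le> n"
  shows "moment (moment_map n \<mu>) k = (\<integral>t. t ^ k \<partial>\<mu>)"
proof -
  interpret prob_space \<mu> using prob_measures_unit_borelD[OF assms(1)] by simp
  show ?thesis using assms(2) by (auto simp: moment_def moment_map_def prob_space)
qed

lemma moment_map_eqI:
  assumes "\<mu> \<in> prob_measures unit_borel" "q \<in> space (Rn_borel n)"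
    and "\<And>k. k \<in> {1..n} \<Longrightarrow> (\<integral>t. t ^ k \<partial>\<mu>) = q k"
  shows "moment_map n \<mu> = q"
  using assms(2,3) by (auto simp: moment_map_def Rn_borel_def space_PiM PiE_def extensional_def)

lemma moment_hull_subset_moment_space:
  assumes "D \<subseteq> {0..1}"
  shows "moment_hull n D \<subseteq> moment_space n"
proof
  fix q assume "q \<in> moment_hull n D"
  then obtain X c where X: "X \<subseteq> D" "represents n q X c" and q: "q \<in> space (Rn_borel n)"
    by (auto simp: moment_hull_def)
  then have fin: "finite X" by (simp add: represents_def)
  from finite_distinct_list[OF this] obtain xs where xs: "set xs = X" "distinct xs" by auto
  define z where "z = ((\<lambda>i. c (xs ! i)), (\<lambda>i. xs ! i))"
  have sum_nth: "(\<Sum>i<length xs. f (xs ! i)) = sum f X" for f :: "real \<Rightarrow> real"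
    using sum.reindex_bij_betw[OF bij_betw_nth[OF xs(2) refl xs(1)[symmetric]], of f] by simp
  have mom: "moment q k = (\<Sum>i<length xs. fst z i * snd z i ^ k)" if "k \<le> n" for k
    using X(2) that sum_nth[of "\<lambda>x. c x * x ^ k"] by (simp add: represents_def z_def)
  have pos: "0 \<le> c (xs ! i)" "xs ! i \<in> {0..1}" if "i < length xs" for i
    using X assms that xs nth_mem[of i xs] by (auto simp: represents_def)
  have z: "z \<in> atom_data (length xs)"
    using pos mom[of 0] by (auto simp: atom_data_def z_def moment_def)
  have "(\<Sum>i<length xs. fst z i * snd z i ^ k) = q k" if "k \<in> {1..n}" for k
    using mom[of k] that by (simp add: moment_def)
  then have "moment_map n (atomic (length xs) z) = q"
    using q by (intro moment_map_eqI[OF atomic_in_prob_measures[OF z]])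
      (auto simp: integral_atomic[OF z] borel_measurable_unit_borel continuous_intros)
  then show "q \<in> moment_space n"
    using atomic_in_prob_measures[OF z] by (auto simp: moment_space_def)
qed

section \<open>Homotheties and volume\<close>

definition homothety :: "nat \<Rightarrow> real \<Rightarrow> (nat \<Rightarrow> real) \<Rightarrow> (nat \<Rightarrow> real) \<Rightarrow> (nat \<Rightarrow> real)" where
  "homothety n \<alpha> v q = (\<lambda>i\<in>{1..n}. \<alpha> * q i + v i)"

lemma space_Rn_lborel: "space (Rn_lborel n) = space (Rn_borel n)"
  and sets_Rn_lborel: "sets (Rn_lborel n) = sets (Rn_borel n)"
  by (auto simp: Rn_lborel_def Rn_borel_def space_PiM intro!: sets_PiM_cong)

lemma homothety_in_space: "homothety n \<alpha> v q \<in> space (Rn_borel n)"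
  by (simp add: homothety_def Rn_borel_def space_PiM)

lemma measurable_homothety [measurable]:
  "homothety n \<alpha> v \<in> measurable (Rn_borel n) (Rn_borel n)"
  unfolding homothety_def Rn_borel_def
  by (intro measurable_restrict borel_measurable_add borel_measurable_times borel_measurable_const
      measurable_component_singleton)

lemma homothety_one: "q \<in> space (Rn_borel n) \<Longrightarrow> homothety n 1 (\<lambda>_. 0) q = q"
  by (auto simp: homothety_def Rn_borel_def space_PiM PiE_def extensional_def)

lemma emeasure_lborel_affine_vimage:
  fixes \<alpha> b :: real
  assumes "0 < \<alpha>" "A \<in> sets borel"
  shows "ennreal \<alpha> * emeasure lborel {x. \<alpha> * x + b \<in> A} = emeasure lborel A"
proof -
  have "emeasure lborel A = (\<integral>\<^sup>+x. indicator A x \<partial>lborel)" using assms by simp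
  also have "\<dots> = \<alpha> * (\<integral>\<^sup>+x. indicator A (b + \<alpha> * x) \<partial>lborel)"
    using assms nn_integral_real_affine[of "indicator A" \<alpha> b] by simp
  also have "(\<integral>\<^sup>+x. indicator A (b + \<alpha> * x) \<partial>lborel)
      = (\<integral>\<^sup>+x. indicator {x. \<alpha> * x + b \<in> A} x \<partial>lborel)"
    by (intro nn_integral_cong) (auto simp: indicator_def add.commute)
  also have "\<dots> = emeasure lborel {x. \<alpha> * x + b \<in> A}"
  proof (rule nn_integral_indicator)
    have "(\<lambda>x. \<alpha> * x + b) -` A \<inter> space borel \<in> sets borel"
      using assms(2) by (intro measurable_sets[of _ borel borel]) auto
    then show "{x. \<alpha> * x + b \<in> A} \<in> sets lborel" by (simp add: vimage_def)
  qed
  finally show ?thesis by simp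
qed

lemma emeasure_homothety_vimage:
  assumes "0 < \<alpha>" "A \<in> sets (Rn_borel n)"
  shows "ennreal (\<alpha> ^ n) * emeasure (Rn_lborel n) {q \<in> space (Rn_borel n). homothety n \<alpha> v q \<in> A}
    = emeasure (Rn_lborel n) A"
proof -
  interpret product_sigma_finite "\<lambda>_ :: nat. lborel :: real measure"
    by standard
  have T: "homothety n \<alpha> v \<in> measurable (Rn_lborel n) (Rn_lborel n)"
    using measurable_homothety by (simp add: measurable_cong_sets[OF sets_Rn_lborel sets_Rn_lborel])
  define P where "P = scale_measure (\<alpha> ^ n) (distr (Rn_lborel n) (Rn_lborel n) (homothety n \<alpha> v))"
  have emP: "emeasure P B = ennreal (\<alpha> ^ n) * emeasure (Rn_lborel n) {q \<in> space (Rn_borel n). homothety n \<alpha> v q \<in> B}"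
    if "B \<in> sets (Rn_borel n)" for B
    using that T by (simp add: P_def emeasure_distr sets_Rn_lborel space_Rn_lborel vimage_def Int_def conj_commute)
  have "Rn_lborel n = P"
    unfolding Rn_lborel_def
  proof (rule PiM_eqI[symmetric])
    show "finite {1..n}" by simp
    show "sets P = sets (PiM {1..n} (\<lambda>_. lborel))" by (simp add: P_def Rn_lborel_def)
    fix A :: "nat \<Rightarrow> real set" assume A: "\<And>i. i \<in> {1..n} \<Longrightarrow> A i \<in> sets lborel"
    have box: "PiE {1..n} A \<in> sets (Rn_borel n)"
      unfolding Rn_borel_def using A by (intro sets_PiM_I_finite) auto
    have pre: "{x. \<alpha> * x + v i \<in> A i} \<in> sets lborel" if "i \<in> {1..n}" for i
    proof -
      have "(\<lambda>x. \<alpha> * x + v i) -` A i \<inter> space borel \<in> sets borel"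
        using A[OF that] by (intro measurable_sets[of _ borel borel]) auto
      then show ?thesis by (simp add: vimage_def)
    qed
    have "{q \<in> space (Rn_borel n). homothety n \<alpha> v q \<in> PiE {1..n} A}
        = PiE {1..n} (\<lambda>i. {x. \<alpha> * x + v i \<in> A i})"
      by (auto simp: homothety_def Rn_borel_def space_PiM PiE_def Pi_def)
    then have "emeasure P (PiE {1..n} A)
        = ennreal (\<alpha> ^ n) * (\<Prod>i\<in>{1..n}. emeasure lborel {x. \<alpha> * x + v i \<in> A i})"
      using emP[OF box] emeasure_PiM[of "{1..n}" "\<lambda>i. {x. \<alpha> * x + v i \<in> A i}"] pre
      by (simp add: Rn_lborel_def)
    also have "\<dots> = (\<Prod>i\<in>{1..n}. ennreal \<alpha> * emeasure lborel {x. \<alpha> * x + v i \<in> A i})"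
      using assms(1) by (simp add: prod.distrib ennreal_power)
    also have "\<dots> = (\<Prod>i\<in>{1..n}. emeasure lborel (A i))"
      using A assms(1) by (intro prod.cong refl emeasure_lborel_affine_vimage) auto
    finally show "emeasure P (PiE {1..n} A) = (\<Prod>i\<in>{1..n}. emeasure lborel (A i))" .
  qed
  then show ?thesis using emP[OF assms(2)] by simp
qed

text \<open>Atoms in \<open>D - D'\<close> are moved to the nodes \<open>R\<close> by Lagrange interpolation. The atoms to be
moved have total weight at most \<open>1\<close>, so the weight received by \<open>r\<close> is at least \<open>- b r\<close>; the
translation part of the homothety contributes exactly the missing \<open>b r\<close>.\<close>

lemma replace_atoms:
  assumes R: "finite R" "card R = Suc n" "R \<subseteq> D'"
    and b: "\<And>r. r \<in> R \<Longrightarrow> 0 \<le> b r"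
    and neg: "\<And>x r. x \<in> D - D' \<Longrightarrow> r \<in> R \<Longrightarrow> - b r \<le> poly (lagrange R r) x"
    and \<eta>: "\<eta> = (\<Sum>r\<in>R. b r)"
    and q: "q \<in> space (Rn_borel n)"
    and hull: "homothety n (1 + \<eta>) (\<lambda>k. - (\<Sum>r\<in>R. b r * r ^ k)) q \<in> moment_hull n D"
  shows "q \<in> moment_hull n D'"
proof -
  obtain X c where X: "X \<subseteq> D" "finite X" and c: "\<And>x. x \<in> X \<Longrightarrow> 0 \<le> c x"
    and mom: "\<And>k. k \<le> n \<Longrightarrow>
      moment (homothety n (1 + \<eta>) (\<lambda>k. - (\<Sum>r\<in>R. b r * r ^ k)) q) k = (\<Sum>x\<in>X. c x * x ^ k)"
    using hull by (auto simp: moment_hull_def represents_def)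
  have \<eta>0: "0 \<le> \<eta>" unfolding \<eta> using b by (rule sum_nonneg)
  define X1 X2 where "X1 = X \<inter> D'" and "X2 = X - D'"
  have fin: "finite X1" "finite X2" using X by (auto simp: X1_def X2_def)
  have split: "(\<Sum>x\<in>X. f x) = (\<Sum>x\<in>X1. f x) + (\<Sum>x\<in>X2. f x)" for f :: "real \<Rightarrow> real"
    unfolding X1_def X2_def using X(2) by (simp add: sum.Int_Diff)
  have c1: "(\<Sum>x\<in>X. c x) = 1" using mom[of 0] by (simp add: moment_def)
  have "0 \<le> (\<Sum>x\<in>X1. c x)" using c by (intro sum_nonneg) (auto simp: X1_def)
  then have c2: "(\<Sum>x\<in>X2. c x) \<le> 1" using c1 split[of c] by simp
  define e where "e = (\<lambda>r. (\<Sum>x\<in>X2. c x * poly (lagrange R r) x) + b r)"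
  have e0: "0 \<le> e r" if r: "r \<in> R" for r
  proof -
    have "(\<Sum>x\<in>X2. c x) * b r \<le> 1 * b r" using c2 b[OF r] by (intro mult_right_mono)
    moreover have "(\<Sum>x\<in>X2. c x * (- b r)) \<le> (\<Sum>x\<in>X2. c x * poly (lagrange R r) x)"
      using X c neg[OF _ r] by (intro sum_mono mult_left_mono) (auto simp: X2_def)
    ultimately show ?thesis by (simp add: e_def sum_distrib_right sum_negf)
  qed
  define w where "w = (\<lambda>y. ((if y \<in> X1 then c y else 0) + (if y \<in> R then e y else 0)) / (1 + \<eta>))"
  have "moment q k = (\<Sum>y\<in>X1 \<union> R. w y * y ^ k)" if k: "k \<le> n" for k
  proof -
    have "(1 + \<eta>) * moment q k = (\<Sum>x\<in>X. c x * x ^ k) + (\<Sum>r\<in>R. b r * r ^ k)"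
      using mom[OF k] k \<eta> by (cases "k = 0") (auto simp: homothety_def moment_def)
    also have "(\<Sum>x\<in>X. c x * x ^ k) = (\<Sum>x\<in>X1. c x * x ^ k) + (\<Sum>x\<in>X2. c x * x ^ k)" by (rule split)
    also have "(\<Sum>x\<in>X2. c x * x ^ k) = (\<Sum>x\<in>X2. \<Sum>r\<in>R. c x * poly (lagrange R r) x * r ^ k)"
      by (subst power_lagrange[OF R(1,2) k]) (simp add: sum_distrib_left mult_ac)
    also have "\<dots> = (\<Sum>r\<in>R. (\<Sum>x\<in>X2. c x * poly (lagrange R r) x) * r ^ k)"
      by (subst sum.swap) (simp add: sum_distrib_right)
    finally have "(1 + \<eta>) * moment q k = (\<Sum>x\<in>X1. c x * x ^ k) + (\<Sum>r\<in>R. e r * r ^ k)"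
      by (simp add: e_def algebra_simps sum.distrib)
    also have "(\<Sum>x\<in>X1. c x * x ^ k) = (\<Sum>y\<in>X1 \<union> R. (if y \<in> X1 then c y else 0) * y ^ k)"
      using fin R(1) by (intro sum.mono_neutral_cong_left) auto
    also have "(\<Sum>r\<in>R. e r * r ^ k) = (\<Sum>y\<in>X1 \<union> R. (if y \<in> R then e y else 0) * y ^ k)"
      using fin R(1) by (intro sum.mono_neutral_cong_left) auto
    finally have *: "(1 + \<eta>) * moment q k = (\<Sum>y\<in>X1 \<union> R. (if y \<in> X1 then c y else 0) * y ^ k)
        + (\<Sum>y\<in>X1 \<union> R. (if y \<in> R then e y else 0) * y ^ k)" .
    have "(1 + \<eta>) * moment q k = (1 + \<eta>) * (\<Sum>y\<in>X1 \<union> R. w y * y ^ k)"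
    proof -
      have "(1 + \<eta>) * w y = (if y \<in> X1 then c y else 0) + (if y \<in> R then e y else 0)" for y
        using \<eta>0 by (simp add: w_def)
      then have "(1 + \<eta>) * (\<Sum>y\<in>X1 \<union> R. w y * y ^ k)
          = (\<Sum>y\<in>X1 \<union> R. ((if y \<in> X1 then c y else 0) + (if y \<in> R then e y else 0)) * y ^ k)"
        by (simp add: sum_distrib_left mult.assoc[symmetric])
      then show ?thesis using * by (simp only: distrib_right sum.distrib)
    qed
    then show ?thesis using \<eta>0 by simp
  qed
  moreover have "0 \<le> w y" if "y \<in> X1 \<union> R" for y
    using c e0 \<eta>0 by (auto simp: w_def X1_def intro!: divide_nonneg_nonneg add_nonneg_nonneg)
  ultimately have "represents n q (X1 \<union> R) w" using fin R(1) by (auto simp: represents_def)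
  moreover have "X1 \<union> R \<subseteq> D'" using R by (auto simp: X1_def)
  ultimately show ?thesis using q unfolding moment_hull_def by blast
qed

section \<open>Rational nodes represent almost all moment vectors\<close>

definition unit_rationals :: "real set" where
  "unit_rationals = \<rat> \<inter> {0..1}"

lemma infinite_rationals_between:
  fixes a b :: real
  assumes "a < b"
  shows "infinite (\<rat> \<inter> {a<..<b})"
proof
  assume fin: "finite (\<rat> \<inter> {a<..<b})"
  obtain r where "r \<in> \<rat>" "a < r" "r < b" using Rats_dense_in_real[OF assms] by blast
  then have "Max (\<rat> \<inter> {a<..<b}) \<in> \<rat> \<inter> {a<..<b}" using fin by (intro Max_in) auto
  then have m: "a < Max (\<rat> \<inter> {a<..<b})" "Max (\<rat> \<inter> {a<..<b}) < b" by auto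
  then obtain s where s: "s \<in> \<rat>" "Max (\<rat> \<inter> {a<..<b}) < s" "s < b"
    using Rats_dense_in_real by blast
  then have "s \<le> Max (\<rat> \<inter> {a<..<b})" using fin m by (intro Max_ge) auto
  with s show False by simp
qed

lemma unit_rationals: "infinite unit_rationals" "countable unit_rationals" "unit_rationals \<subseteq> {0..1}"
proof -
  have "\<rat> \<inter> {0<..<1::real} \<subseteq> unit_rationals" by (auto simp: unit_rationals_def)
  then show "infinite unit_rationals" using infinite_rationals_between[of 0 1] infinite_super by auto
  show "countable unit_rationals"
    unfolding unit_rationals_def using countable_rat by (rule countable_subset[rotated]) auto
qed (auto simp: unit_rationals_def)

lemma sum_level_sets:
  fixes f :: "real \<Rightarrow> real"
  assumes \<mu>: "\<mu> \<in> prob_measures unit_borel" and f: "f \<in> borel_measurable unit_borel"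
    and X: "finite X" "\<And>t. t \<in> {0..1} \<Longrightarrow> f t \<in> X"
  shows "(\<Sum>x\<in>X. measure \<mu> {t \<in> {0..1}. f t = x} * x ^ k) = (\<integral>t. f t ^ k \<partial>\<mu>)"
proof -
  note \<mu>' = prob_measures_unit_borelD[OF \<mu>]
  interpret prob_space \<mu> by (rule \<mu>')
  have "f \<in> borel_measurable \<mu>" using f \<mu>'(2) by (simp cong: measurable_cong_sets)
  then have sets: "{t \<in> {0..1}. f t = x} \<in> sets \<mu>" for x
    using \<mu>'(3) measurable_sets[of f \<mu> borel "{x}"] by (simp add: vimage_def Int_def conj_commute)
  have "(\<integral>t. f t ^ k \<partial>\<mu>) = (\<integral>t. (\<Sum>x\<in>X. indicator {t \<in> {0..1}. f t = x} t * x ^ k) \<partial>\<mu>)"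
  proof (intro Bochner_Integration.integral_cong refl)
    fix t assume "t \<in> space \<mu>"
    then have "t \<in> {0..1}" using \<mu>'(3) by simp
    then have "(\<Sum>x\<in>X. indicator {t \<in> {0..1}. f t = x} t * x ^ k) = (\<Sum>x\<in>X. if x = f t then x ^ k else 0)"
      by (intro sum.cong) (auto simp: indicator_def)
    then show "f t ^ k = (\<Sum>x\<in>X. indicator {t \<in> {0..1}. f t = x} t * x ^ k)"
      using X \<open>t \<in> {0..1}\<close> by simp
  qed
  also have "\<dots> = (\<Sum>x\<in>X. measure \<mu> {t \<in> {0..1}. f t = x} * x ^ k)"
    using sets by (subst Bochner_Integration.integral_sum) (auto simp: emeasure_eq_measure sets.Int_space_eq2)
  finally show ?thesis by simp
qed

lemma rounded_moments:
  assumes \<mu>: "\<mu> \<in> prob_measures unit_borel" and m: "0 < m"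
  obtains X c where "X \<subseteq> unit_rationals" "finite X" "\<And>x. 0 \<le> c x"
    "\<And>k. \<bar>(\<integral>t. t ^ k \<partial>\<mu>) - (\<Sum>x\<in>X. c x * x ^ k)\<bar> \<le> real k / real m"
proof -
  note \<mu>' = prob_measures_unit_borelD[OF \<mu>]
  interpret prob_space \<mu> by (rule \<mu>')
  define f where "f = (\<lambda>t. of_int \<lfloor>real m * t\<rfloor> / real m)"
  define X where "X = (\<lambda>j. real j / real m) ` {..m}"
  have X: "finite X" "X \<subseteq> unit_rationals" using m by (auto simp: X_def unit_rationals_def)
  have fX: "f t \<in> X" if "t \<in> {0..1}" for t
  proof -
    have "real m * t \<le> real m" using that by (simp add: mult_left_le)
    then have fl: "0 \<le> \<lfloor>real m * t\<rfloor>" "\<lfloor>real m * t\<rfloor> \<le> int m"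
      using that by (auto simp: floor_le_iff)
    then have "f t = real (nat \<lfloor>real m * t\<rfloor>) / real m" by (simp add: f_def)
    then show ?thesis unfolding X_def using fl by (intro image_eqI[of _ _ "nat \<lfloor>real m * t\<rfloor>"]) auto
  qed
  have f01: "f t \<in> {0..1}" if "t \<in> {0..1}" for t
    using fX[OF that] X unit_rationals(3) by blast
  have near: "\<bar>t - f t\<bar> \<le> 1 / real m" for t
  proof -
    have "\<bar>real m * t - of_int \<lfloor>real m * t\<rfloor>\<bar> \<le> 1" by linarith
    moreover have "t - f t = (real m * t - of_int \<lfloor>real m * t\<rfloor>) / real m"
      using m by (simp add: f_def field_simps)
    ultimately show ?thesis using m by (simp add: abs_divide divide_right_mono)
  qed
  have f: "f \<in> borel_measurable unit_borel"
    unfolding f_def unit_borel_def by (intro measurable_restrict_space1) measurable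
  have f\<mu>: "f \<in> borel_measurable \<mu>" and id\<mu>: "(\<lambda>t. t) \<in> borel_measurable \<mu>"
    using f borel_measurable_unit_borel[OF continuous_on_id] \<mu>'(2)
    by (simp_all cong: measurable_cong_sets)
  have int: "integrable \<mu> (\<lambda>t. f t ^ k)" "integrable \<mu> (\<lambda>t. t ^ k)" for k
  proof -
    show "integrable \<mu> (\<lambda>t. f t ^ k)"
      using f01 \<mu>'(3) f\<mu> by (intro integrable_const_bound[where B = 1] AE_I2) (auto simp: power_le_one power_abs)
    show "integrable \<mu> (\<lambda>t. t ^ k)"
      using \<mu>'(3) id\<mu> by (intro integrable_const_bound[where B = 1] AE_I2) (auto simp: power_le_one power_abs)
  qed
  define c where "c = (\<lambda>x. measure \<mu> {t \<in> {0..1}. f t = x})"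
  have "\<bar>(\<integral>t. t ^ k \<partial>\<mu>) - (\<Sum>x\<in>X. c x * x ^ k)\<bar> \<le> real k / real m" for k
  proof -
    have "(\<Sum>x\<in>X. c x * x ^ k) = (\<integral>t. f t ^ k \<partial>\<mu>)"
      unfolding c_def by (rule sum_level_sets[OF \<mu> f X(1) fX])
    then have "(\<integral>t. t ^ k \<partial>\<mu>) - (\<Sum>x\<in>X. c x * x ^ k) = (\<integral>t. t ^ k - f t ^ k \<partial>\<mu>)"
      using int by simp
    also have "\<bar>\<dots>\<bar> \<le> (\<integral>t. \<bar>t ^ k - f t ^ k\<bar> \<partial>\<mu>)" by (rule integral_abs_bound)
    also have "\<dots> \<le> (\<integral>t. real k / real m \<partial>\<mu>)"
    proof (rule integral_mono)
      fix t assume "t \<in> space \<mu>"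
      then have t: "t \<in> {0..1}" using \<mu>'(3) by simp
      have "\<bar>t ^ k - f t ^ k\<bar> \<le> real k * \<bar>t - f t\<bar>"
        using norm_power_diff[of t "f t" k] t f01[OF t] by simp
      also have "\<dots> \<le> real k * (1 / real m)" using near by (intro mult_left_mono) auto
      finally show "\<bar>t ^ k - f t ^ k\<bar> \<le> real k / real m" by simp
    qed (use int in auto)
    finally show ?thesis by (simp add: prob_space)
  qed
  then show ?thesis using X by (intro that[of X c]) (auto simp: c_def)
qed

text \<open>Rounding the measure to the grid of mesh \<open>1 / m\<close> changes the moments by \<open>O(1 / m)\<close>. The
error is a combination of fixed rational nodes with coefficients \<open>O(1 / m)\<close>, because the Riesz
functional is linear, and these are made nonnegative by a homothety of ratio \<open>1 - O(1 / m)\<close>.\<close>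

lemma moment_space_near_hull:
  obtains C r where "0 \<le> C" "\<And>m q. 0 < m \<Longrightarrow> q \<in> moment_space n \<Longrightarrow>
    homothety n (1 / (1 + C / real m)) (\<lambda>k. r m k) q \<in> moment_hull n unit_rationals"
proof -
  obtain R where R: "finite R" "card R = Suc n" "R \<subseteq> unit_rationals"
    using infinite_arbitrarily_large[OF unit_rationals(1)] by blast
  \<comment> \<open>bounds the effect on the interpolation weights of changing each \<open>k\<close>-th moment by at most \<open>k\<close>\<close>
  define C0 where "C0 = (\<Sum>r\<in>R. \<Sum>k\<le>n. \<bar>coeff (lagrange R r) k\<bar> * real k)"
  define r where "r = (\<lambda>(m::nat) k. (C0 / real m) * (\<Sum>y\<in>R. y ^ k) / (1 + real (Suc n) * C0 / real m))"
  have C0: "0 \<le> C0" unfolding C0_def by (intro sum_nonneg) auto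
  have "homothety n (1 / (1 + (real (Suc n) * C0) / real m)) (\<lambda>k. r m k) q \<in> moment_hull n unit_rationals"
    if m: "0 < m" and "q \<in> moment_space n" for m q
  proof -
    define b where "b = C0 / real m"
    define \<eta> where "\<eta> = real (Suc n) * b"
    have b0: "0 \<le> b" "0 \<le> \<eta>" using C0 m by (auto simp: b_def \<eta>_def)
    obtain \<mu> where \<mu>: "\<mu> \<in> prob_measures unit_borel" "q = moment_map n \<mu>"
      using \<open>q \<in> moment_space n\<close> by (auto simp: moment_space_def)
    obtain X c where X: "X \<subseteq> unit_rationals" "finite X" and c: "\<And>x. 0 \<le> c x"
      and close0: "\<And>k. \<bar>(\<integral>t. t ^ k \<partial>\<mu>) - (\<Sum>x\<in>X. c x * x ^ k)\<bar> \<le> real k / real m"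
      using rounded_moments[OF \<mu>(1) m] by metis
    define p where "p = (\<lambda>k. \<Sum>x\<in>X. c x * x ^ k)"
    have close: "\<bar>moment q k - moment p k\<bar> \<le> real k / real m" if "k \<le> n" for k
      using close0[of k] that moment_moment_map[OF \<mu>(1) that] unfolding \<mu>(2) p_def
      by (auto simp: moment_def)
    have p0: "moment p k = (\<Sum>x\<in>X. c x * x ^ k)" for k
    proof (cases "k = 0")
      case True
      interpret prob_space \<mu> using prob_measures_unit_borelD[OF \<mu>(1)] by simp
      show ?thesis using close0[of 0] True
        by (simp add: moment_def prob_space)
    qed (simp add: moment_def p_def)
    define e where "e = (\<lambda>y. riesz n q (lagrange R y) - riesz n p (lagrange R y) + b)"
    have e0: "0 \<le> e y" if y: "y \<in> R" for y
    proof -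
      have "\<bar>riesz n q (lagrange R y) - riesz n p (lagrange R y)\<bar>
          = \<bar>\<Sum>k\<le>n. coeff (lagrange R y) k * (moment q k - moment p k)\<bar>"
        by (simp add: riesz_def sum_subtractf algebra_simps)
      also have "\<dots> \<le> (\<Sum>k\<le>n. \<bar>coeff (lagrange R y) k\<bar> * (real k / real m))"
        by (intro order_trans[OF sum_abs] sum_mono, unfold abs_mult, intro mult_left_mono close) auto
      also have "\<dots> = (\<Sum>k\<le>n. \<bar>coeff (lagrange R y) k\<bar> * real k) / real m"
        by (simp add: sum_divide_distrib)
      also have "\<dots> \<le> b" unfolding b_def C0_def
        using R(1) y by (intro divide_right_mono member_le_sum[of y R "\<lambda>r. \<Sum>k\<le>n. \<bar>coeff (lagrange R r) k\<bar> * real k"])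
          (auto intro!: sum_nonneg)
      finally show ?thesis by (simp add: e_def abs_le_iff)
    qed
    define w where "w = (\<lambda>y. ((if y \<in> X then c y else 0) + (if y \<in> R then e y else 0)) / (1 + \<eta>))"
    have "moment (homothety n (1 / (1 + \<eta>)) (\<lambda>k. r m k) q) k = (\<Sum>y\<in>X \<union> R. w y * y ^ k)"
      if k: "k \<le> n" for k
    proof -
      have qk: "moment q k = moment p k + (\<Sum>y\<in>R. (e y - b) * y ^ k)"
        unfolding moments_lagrange[OF R(1,2) k, of q] moments_lagrange[OF R(1,2) k, of p]
        by (simp add: e_def sum.distrib[symmetric] algebra_simps)
      have "(1 + \<eta>) * moment (homothety n (1 / (1 + \<eta>)) (\<lambda>k. r m k) q) k
          = moment q k + b * (\<Sum>y\<in>R. y ^ k)"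
      proof (cases "k = 0")
        case False
        have "r m k = b * (\<Sum>y\<in>R. y ^ k) / (1 + \<eta>)" by (simp add: r_def b_def \<eta>_def)
        then show ?thesis using False k b0 by (simp add: moment_def homothety_def distrib_left)
      qed (use R(2) in \<open>simp add: moment_def \<eta>_def mult.commute\<close>)
      also have "\<dots> = (\<Sum>x\<in>X. c x * x ^ k) + (\<Sum>y\<in>R. e y * y ^ k)"
        by (simp add: qk p0 algebra_simps sum_subtractf sum_distrib_left)
      also have "(\<Sum>x\<in>X. c x * x ^ k) = (\<Sum>y\<in>X \<union> R. (if y \<in> X then c y else 0) * y ^ k)"
        using X R(1) by (intro sum.mono_neutral_cong_left) auto
      also have "(\<Sum>r\<in>R. e r * r ^ k) = (\<Sum>y\<in>X \<union> R. (if y \<in> R then e y else 0) * y ^ k)"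
        using X R(1) by (intro sum.mono_neutral_cong_left) auto
      also have "(\<Sum>y\<in>X \<union> R. (if y \<in> X then c y else 0) * y ^ k) + \<dots>
          = (1 + \<eta>) * (\<Sum>y\<in>X \<union> R. w y * y ^ k)"
      proof -
        have "(1 + \<eta>) * w y = (if y \<in> X then c y else 0) + (if y \<in> R then e y else 0)" for y
          using b0 by (simp add: w_def)
        then show ?thesis
          by (simp only: sum_distrib_left mult.assoc[symmetric] distrib_right sum.distrib)
      qed
      finally show ?thesis using b0 by simp
    qed
    moreover have "0 \<le> w y" for y
      using c e0 b0 by (auto simp: w_def intro!: divide_nonneg_nonneg add_nonneg_nonneg)
    ultimately have "represents n (homothety n (1 / (1 + \<eta>)) (\<lambda>k. r m k) q) (X \<union> R) w"
      using X R by (auto simp: represents_def)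
    moreover have "X \<union> R \<subseteq> unit_rationals" using X R by simp
    ultimately have "homothety n (1 / (1 + \<eta>)) (\<lambda>k. r m k) q \<in> moment_hull n unit_rationals"
      using homothety_in_space unfolding moment_hull_def by blast
    then show ?thesis by (simp add: \<eta>_def b_def)
  qed
  then show ?thesis using C0 by (intro that[of "real (Suc n) * C0" r]) auto
qed

text \<open>The homotheties of the previous lemma shrink volumes by factors tending to \<open>1\<close>.\<close>

lemma emeasure_moment_space_le_hull:
  assumes "emeasure (Rn_lborel n) (moment_space n) < \<infinity>"
  shows "emeasure (Rn_lborel n) (moment_space n) \<le> emeasure (Rn_lborel n) (moment_hull n unit_rationals)"
proof -
  let ?M = "moment_space n" and ?H = "moment_hull n unit_rationals"
  let ?vol = "emeasure (Rn_lborel n)"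
  have H: "?H \<in> sets (Rn_borel n)"
    using sets_simplex_union[OF unit_rationals(2)] by (simp add: moment_hull_eq unit_rationals)
  obtain C r where C: "0 \<le> C" and sub: "\<And>m q. 0 < m \<Longrightarrow> q \<in> ?M \<Longrightarrow>
    homothety n (1 / (1 + C / real m)) (\<lambda>k. r m k) q \<in> ?H"
    using moment_space_near_hull by metis
  have le: "ennreal ((1 / (1 + C / real (Suc m))) ^ n) * ?vol ?M \<le> ?vol ?H" for m
  proof -
    let ?\<alpha> = "1 / (1 + C / real (Suc m))"
    have pos: "0 < ?\<alpha>" using C by (simp add: add_pos_nonneg)
    let ?P = "{q \<in> space (Rn_borel n). homothety n ?\<alpha> (r (Suc m)) q \<in> ?H}"
    have "?P \<in> sets (Rn_lborel n)"
      unfolding sets_Rn_lborel using H by measurable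
    moreover have "?M \<subseteq> ?P" using sub[of "Suc m"] moment_map_in_space by (auto simp: moment_space_def)
    ultimately have "?vol ?M \<le> ?vol ?P" by (rule emeasure_mono[rotated])
    then have "ennreal (?\<alpha> ^ n) * ?vol ?M \<le> ennreal (?\<alpha> ^ n) * ?vol ?P" by (rule mult_left_mono) simp
    also have "\<dots> = ?vol ?H" by (rule emeasure_homothety_vimage[OF pos H])
    finally show ?thesis .
  qed
  have "(\<lambda>m. C / real (Suc m)) \<longlonglongrightarrow> 0"
    using LIMSEQ_Suc[OF lim_const_over_n[of C]] by simp
  then have "(\<lambda>m. (1 / (1 + C / real (Suc m))) ^ n) \<longlonglongrightarrow> (1 / (1 + 0)) ^ n"
    by (intro tendsto_intros) auto
  then have "(\<lambda>m. ennreal ((1 / (1 + C / real (Suc m))) ^ n)) \<longlonglongrightarrow> ennreal 1"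
    by (intro tendsto_ennrealI) simp
  then have "(\<lambda>m. ?vol ?M * ennreal ((1 / (1 + C / real (Suc m))) ^ n)) \<longlonglongrightarrow> ?vol ?M * ennreal 1"
    using assms by (intro ennreal_tendsto_cmult) auto
  then have "(\<lambda>m. ennreal ((1 / (1 + C / real (Suc m))) ^ n) * ?vol ?M) \<longlonglongrightarrow> ?vol ?M"
    by (simp only: mult.commute[of "?vol ?M"]) simp
  then show ?thesis using le by (intro LIMSEQ_le_const2[where X = "\<lambda>m. ennreal ((1 / (1 + C / real (Suc m))) ^ n) * ?vol ?M"]) auto
qed

section \<open>Representing measures that avoid a ball\<close>

lemma prod_abs_diff_index:
  "(\<Prod>j\<in>{..i + k} - {i}. \<bar>real i - real j\<bar>) = fact i * fact k"
proof (induction k)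
  case 0
  have "{..i} - {i} = {0..<i}" by auto
  then have "(\<Prod>j\<in>{..i} - {i}. \<bar>real i - real j\<bar>) = (\<Prod>j\<in>{0..<i}. real (i - j))"
    by (intro prod.cong) (auto simp: of_nat_diff)
  also have "\<dots> = fact i" by (simp add: fact_prod_rev)
  finally show ?case by simp
next
  case (Suc k)
  have "{..i + Suc k} - {i} = insert (i + Suc k) ({..i + k} - {i})" by auto
  then show ?case using Suc by (simp add: algebra_simps)
qed

text \<open>With nodes \<open>0, ..., n\<close> this is the value at \<open>-v\<close> of the \<open>i\<close>-th Lagrange polynomial. For
\<open>i > 0\<close> it contains the factor \<open>v\<close> coming from the node \<open>0\<close>, and the remaining factors are largest
at \<open>v = 1\<close>, where they give the binomial coefficient; for \<open>i = 0\<close> it is positive.\<close>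

lemma lagrange_outside_bound:
  fixes u v :: real
  assumes i: "i \<le> n" and v: "0 \<le> v" "v \<le> u" "u \<le> 1"
  shows "- (u * real (Suc n choose Suc i)) \<le> (\<Prod>j\<in>{..n} - {i}. - (v + real j) / (real i - real j))"
proof (cases "i = 0")
  case True
  have "0 \<le> (\<Prod>j\<in>{..n} - {i}. - (v + real j) / (real i - real j))"
    using True v by (intro prod_nonneg ballI divide_nonpos_nonpos) auto
  moreover have "0 \<le> u * real (Suc n choose Suc i)" using v by simp
  ultimately show ?thesis by linarith
next
  case False
  let ?J = "{..n} - {i} - {0}"
  have "(\<Prod>j\<le>n. real j + 1) = fact (Suc n)"
    using fact_prod_Suc[of "Suc n", where 'a = real] by (simp add: atLeast0LessThan lessThan_Suc_atMost add.commute)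
  moreover have "(\<Prod>j\<le>n. real j + 1) = (real i + 1) * (\<Prod>j\<in>?J. real j + 1)"
    using i False by (subst prod.remove[of _ i], simp, simp, subst prod.remove[of _ 0]) auto
  ultimately have top: "(\<Prod>j\<in>?J. real j + 1) = fact (Suc n) / (real i + 1)" by (simp add: field_simps)
  have "\<bar>\<Prod>j\<in>{..n} - {i}. - (v + real j) / (real i - real j)\<bar>
      = (\<Prod>j\<in>{..n} - {i}. v + real j) / (\<Prod>j\<in>{..n} - {i}. \<bar>real i - real j\<bar>)"
    using v by (simp add: abs_prod abs_divide prod_dividef[symmetric] add.commute del: prod_dividef)
  also have "(\<Prod>j\<in>{..n} - {i}. \<bar>real i - real j\<bar>) = fact i * fact (n - i)"
    using prod_abs_diff_index[of i "n - i"] i by simp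
  also have "(\<Prod>j\<in>{..n} - {i}. v + real j) = v * (\<Prod>j\<in>?J. v + real j)"
    using False by (subst prod.remove[of _ 0]) auto
  also have "\<dots> / (fact i * fact (n - i)) \<le> u * (\<Prod>j\<in>?J. real j + 1) / (fact i * fact (n - i))"
    using v by (intro divide_right_mono mult_mono prod_mono prod_nonneg) auto
  also have "\<dots> = u * real (Suc n choose Suc i)"
  proof -
    have "real (Suc n choose Suc i) = fact (Suc n) / (fact (Suc i) * fact (n - i))"
      using i binomial_fact[of "Suc i" "Suc n", where 'a = real]
      by (simp only: Suc_le_mono diff_Suc_Suc)
    moreover have "fact (Suc i) = (real i + 1) * fact i" by simp
    ultimately show ?thesis unfolding top by (simp only: times_divide_eq_right divide_divide_eq_left mult_ac)
  qed
  finally show ?thesis by linarith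
qed

text \<open>The nodes are equidistant, start at the end point \<open>a\<close> of the ball that is nearer to the centre of
the unit interval, and run away from the ball. Every point of the ball then lies beyond the first
node, at distance at most \<open>2 * \<delta>\<close> from it.\<close>

lemma moment_hull_avoiding_ball:
  fixes d \<delta> :: real
  assumes n: "1 \<le> n" and d: "d \<in> {0..1}" and \<delta>: "0 < \<delta>" "\<delta> \<le> 1 / 10" "5 * real n * \<delta> \<le> 1"
  obtains D' \<eta> v where "countable D'" "infinite D'" "D' \<subseteq> {0..1}" "D' \<inter> ball d \<delta> = {}"
    "0 \<le> \<eta>" "\<eta> \<le> 5 * real n * 2 ^ Suc n * \<delta>"
    "\<And>q. q \<in> space (Rn_borel n) \<Longrightarrow> homothety n (1 + \<eta>) v q \<in> moment_hull n unit_rationals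
      \<Longrightarrow> q \<in> moment_hull n D'"
proof -
  define \<sigma> :: real where "\<sigma> = (if d \<le> 1 / 2 then 1 else - 1)"
  have \<sigma>: "\<sigma> = 1 \<or> \<sigma> = - 1" "\<sigma> * \<sigma> = 1" by (auto simp: \<sigma>_def)
  \<comment> \<open>\<open>\<sigma>\<close> points towards the longer side; as \<open>\<delta> \<le> 1 / 10\<close>, the last node \<open>d + \<sigma> * (\<delta> + 2 / 5)\<close> is still in \<open>{0..1}\<close>\<close>
  define h where "h = 2 / (5 * real n)"
  have h: "0 < h" "real n * h = 2 / 5" using n by (auto simp: h_def)
  define u where "u = 5 * real n * \<delta>"
  have u: "0 \<le> u" "u \<le> 1" "u * h = 2 * \<delta>" using n \<delta> by (auto simp: u_def h_def)
  define a where "a = d + \<sigma> * \<delta>"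
  define node where "node = (\<lambda>j :: nat. a + \<sigma> * real j * h)"
  define R where "R = node ` {..n}"
  have inj: "inj node" using \<sigma> h by (auto simp: inj_def node_def)
  have inj_on: "inj_on node A" for A using inj by (rule inj_on_subset) simp
  have R: "finite R" "card R = Suc n" using inj_on by (auto simp: R_def card_image)
  have R01: "node j \<in> {0..1}" and Rball: "node j \<notin> ball d \<delta>" if "j \<le> n" for j
  proof -
    have "0 \<le> real j * h" "real j * h \<le> real n * h" using that h by (auto intro: mult_right_mono)
    then have *: "0 \<le> real j * h" "real j * h \<le> 2 / 5" using h by auto
    show "node j \<in> {0..1}" using * d \<delta> by (auto simp: node_def a_def \<sigma>_def)
    show "node j \<notin> ball d \<delta>" using * d \<delta> by (auto simp: node_def a_def \<sigma>_def dist_real_def)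
  qed
  define D' where "D' = (unit_rationals - ball d \<delta>) \<union> R"
  have "infinite (unit_rationals - ball d \<delta>)"
  proof (cases "d \<le> 1 / 2")
    case True
    have "\<rat> \<inter> {3/5<..<1} \<subseteq> unit_rationals - ball d \<delta>"
      using True \<delta> by (auto simp: unit_rationals_def dist_real_def)
    then show ?thesis using infinite_rationals_between[of "3/5" 1] infinite_super by auto
  next
    case False
    have "\<rat> \<inter> {0<..<2/5} \<subseteq> unit_rationals - ball d \<delta>"
      using False \<delta> by (auto simp: unit_rationals_def dist_real_def)
    then show ?thesis using infinite_rationals_between[of 0 "2/5"] infinite_super by auto
  qed
  then have D': "infinite D'" "countable D'" "D' \<subseteq> {0..1}" "D' \<inter> ball d \<delta> = {}"
    using unit_rationals R01 Rball by (auto simp: D'_def R_def)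
  \<comment> \<open>the bound of \<open>lagrange_outside_bound\<close> at the node with index \<open>inv node r\<close>\<close>
  define b where "b = (\<lambda>r. u * real (Suc n choose Suc (inv node r)))"
  define \<eta> where "\<eta> = (\<Sum>r\<in>R. b r)"
  have b: "0 \<le> b r" for r using u by (simp add: b_def)
  have "\<eta> = (\<Sum>i\<le>n. u * real (Suc n choose Suc i))"
    unfolding \<eta>_def R_def using inj inj_on by (subst sum.reindex) (auto simp: b_def)
  also have "\<dots> = u * real (\<Sum>i\<le>n. Suc n choose Suc i)" by (simp add: sum_distrib_left)
  also have "(\<Sum>i\<le>n. Suc n choose Suc i) \<le> 2 ^ Suc n"
    using choose_row_sum[of "Suc n"] by (simp only: sum.atMost_Suc_shift)
  then have "u * real (\<Sum>i\<le>n. Suc n choose Suc i) \<le> u * real (2 ^ Suc n)"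
    using u by (intro mult_left_mono) (auto simp del: of_nat_sum of_nat_power)
  finally have \<eta>: "\<eta> \<le> 5 * real n * 2 ^ Suc n * \<delta>" by (simp add: u_def mult_ac)
  have neg: "- b r \<le> poly (lagrange R r) x" if x: "x \<in> unit_rationals - D'" and r: "r \<in> R" for x r
  proof -
    obtain i where i: "i \<le> n" "r = node i" using r by (auto simp: R_def)
    define v where "v = \<sigma> * (a - x) / h"
    have "\<bar>d - x\<bar> < \<delta>" using x by (auto simp: D'_def dist_real_def)
    then have "0 \<le> \<sigma> * (a - x)" "\<sigma> * (a - x) \<le> u * h"
      using \<sigma> u(3) by (auto simp: a_def)
    then have v: "0 \<le> v" "v \<le> u" using h by (auto simp: v_def divide_le_eq)
    have xv: "x = a - \<sigma> * v * h"
      using h \<sigma>(2) by (simp add: v_def mult.assoc[symmetric])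
    have "poly (lagrange R r) x = (\<Prod>y\<in>node ` ({..n} - {i}). (x - y) / (r - y))"
      unfolding poly_lagrange R_def i(2) using inj by (simp add: image_set_diff)
    also have "\<dots> = (\<Prod>j\<in>{..n} - {i}. (x - node j) / (r - node j))"
      using inj_on by (subst prod.reindex) auto
    also have "\<dots> = (\<Prod>j\<in>{..n} - {i}. - (v + real j) / (real i - real j))"
    proof (rule prod.cong[OF refl])
      fix j assume "j \<in> {..n} - {i}"
      have "x - node j = (\<sigma> * h) * (- (v + real j))" "r - node j = (\<sigma> * h) * (real i - real j)"
        by (simp_all add: xv i(2) node_def algebra_simps)
      then show "(x - node j) / (r - node j) = - (v + real j) / (real i - real j)"
        using \<sigma> h by (simp only: mult_divide_mult_cancel_left_if) auto
    qed
    finally show ?thesis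
      using lagrange_outside_bound[OF i(1) v u(2)] inj by (simp add: b_def i(2))
  qed
  have "q \<in> moment_hull n D'" if "q \<in> space (Rn_borel n)"
    "homothety n (1 + \<eta>) (\<lambda>k. - (\<Sum>r\<in>R. b r * r ^ k)) q \<in> moment_hull n unit_rationals" for q
    using R b neg \<eta>_def that by (intro replace_atoms[of R n D' b unit_rationals \<eta>]) (auto simp: D'_def)
  moreover have "0 \<le> \<eta>" unfolding \<eta>_def using b by (intro sum_nonneg)
  ultimately show ?thesis using D' \<eta> by (intro that[of D' \<eta>]) auto
qed

section \<open>The uniform distribution on the moment space\<close>

text \<open>A non-measurable set has measure \<open>0\<close> by convention, so the density would take only the
values \<open>0\<close> and \<open>\<infinity>\<close>. The lower integral of such a function is unchanged by doubling it and
cannot be \<open>1\<close>.\<close>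

lemma uniform_measure_prob_space_imp_sets:
  assumes "prob_space (uniform_measure N A)"
  shows "A \<in> sets N"
proof (rule ccontr)
  assume "A \<notin> sets N"
  then have A0: "emeasure N A = 0" by (rule emeasure_notin_sets)
  define g where "g = (\<lambda>x. indicator A x / emeasure N A * indicator (space N) x :: ennreal)"
  have "emeasure (uniform_measure N A) (space N) = 1"
    using prob_space.emeasure_space_1[OF assms] by simp
  then have one: "(\<integral>\<^sup>+x. g x \<partial>N) = 1"
    unfolding uniform_measure_def density_def g_def
    by (simp add: emeasure_measure_of_conv split: if_splits)
  then have "ennreal (1 / 2) < (SUP f \<in> {f. simple_function N f \<and> f \<le> g}. integral\<^sup>S N f)"
    unfolding nn_integral_def using ennreal_lessI[of 1 "1 / 2"] by simp
  then obtain f where f: "simple_function N f" "f \<le> g" "ennreal (1 / 2) < integral\<^sup>S N f"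
    by (auto simp: less_SUP_iff)
  have "g x = 0 \<or> g x = \<infinity>" for x
    by (auto simp: g_def A0 indicator_def)
  then have "2 * f x \<le> g x" for x
    using le_funD[OF f(2), of x] by (metis ennreal_mult_eq_top_iff infinity_ennreal_def le_zero_eq mult_zero_right top_greatest)
  then have "integral\<^sup>S N (\<lambda>x. 2 * f x) \<le> 1"
    unfolding one[symmetric] nn_integral_def using f(1)
    by (intro SUP_upper) (auto simp: le_fun_def)
  then have "2 * integral\<^sup>S N f \<le> 1" using f(1) by (simp add: simple_integral_mult)
  moreover have "2 * ennreal (1 / 2) < 2 * integral\<^sup>S N f"
    using f(3) by (intro ennreal_mult_strict_left_mono) auto
  moreover have "2 * ennreal (1 / 2) = 1"
    by (metis ennreal_1 ennreal_mult'' ennreal_numeral field_sum_of_halves mult_2 mult.commute nonzero_mult_div_cancel_left times_divide_eq_right zero_le_numeral zero_neq_numeral zero_le_divide_1_iff)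
  ultimately show False by auto
qed

section \<open>A measurable choice of representing measures\<close>

text \<open>The first simplex, in an enumeration of the countably many ones, that contains \<open>q\<close> is used;
its vertices and weights are measurable functions of \<open>q\<close>.\<close>

lemma representing_kernel:
  assumes "countable D"
  obtains c x :: "(nat \<Rightarrow> real) \<Rightarrow> nat \<Rightarrow> real" where
    "c \<in> borel_measurable (Rn_borel n)" "x \<in> borel_measurable (Rn_borel n)"
    "\<And>q i. q \<in> simplex_union n D \<Longrightarrow> i \<le> n \<Longrightarrow> 0 \<le> c q i \<and> x q i \<in> D"
    "\<And>q k. q \<in> simplex_union n D \<Longrightarrow> k \<le> n \<Longrightarrow> moment q k = (\<Sum>i\<le>n. c q i * x q i ^ k)"
proof (cases "{X. finite X \<and> X \<subseteq> D \<and> card X = Suc n} = {}")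
  case True
  have "simplex_union n D = {}" unfolding simplex_union_def True by simp
  then show ?thesis by (intro that[of "\<lambda>_ _. 0" "\<lambda>_ _. 0"]) auto
next
  case False
  define e where "e = from_nat_into {X. finite X \<and> X \<subseteq> D \<and> card X = Suc n}"
  have "countable {X. finite X \<and> X \<subseteq> D \<and> card X = Suc n}"
    using countable_Collect_finite_subset[OF assms] by (rule countable_subset[rotated]) auto
  then have range_e: "range e = {X. finite X \<and> X \<subseteq> D \<and> card X = Suc n}"
    using False by (simp add: e_def range_from_nat_into)
  then have e: "finite (e j)" "e j \<subseteq> D" "card (e j) = Suc n" for j by blast+
  define J where "J = (\<lambda>q. LEAST j. q \<in> moment_simplex n (e j))"
  define node where "node = (\<lambda>j i. sorted_list_of_set (e j) ! i)"
  define x where "x = (\<lambda>q. node (J q))"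
  define c where "c = (\<lambda>q i. riesz n q (lagrange (e (J q)) (node (J q) i)))"
  have J: "J \<in> measurable (Rn_borel n) (count_space UNIV)"
    unfolding J_def using e(1) by measurable
  have "x \<in> borel_measurable (Rn_borel n)"
    unfolding x_def by (rule measurable_compose[OF J]) simp
  moreover have "c \<in> borel_measurable (Rn_borel n)"
  proof (rule measurable_coordinatewise_then_product)
    show "(\<lambda>q. c q i) \<in> borel_measurable (Rn_borel n)" for i
      unfolding c_def
      by (rule measurable_compose_countable[where f = "\<lambda>j q. riesz n q (lagrange (e j) (node j i))", OF measurable_riesz J])
  qed
  moreover have "(0 \<le> c q i \<and> x q i \<in> D) \<and> (k \<le> n \<longrightarrow> moment q k = (\<Sum>i\<le>n. c q i * x q i ^ k))"
    if q: "q \<in> simplex_union n D" and i: "i \<le> n" for q i k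
  proof -
    obtain X where "X \<in> range e" "q \<in> moment_simplex n X"
      using q unfolding simplex_union_def range_e[symmetric] by (rule UN_E)
    then obtain j where "q \<in> moment_simplex n (e j)" by (elim imageE) simp
    then have q': "q \<in> moment_simplex n (e (J q))" unfolding J_def by (rule LeastI)
    have bij: "bij_betw (node (J q)) {..n} (e (J q))"
      using bij_betw_nth[of "sorted_list_of_set (e (J q))" "{..n}" "e (J q)"] e[of "J q"]
      by (simp add: node_def lessThan_Suc_atMost)
    have "node (J q) i \<in> e (J q)" using bij i by (auto simp: bij_betw_def)
    moreover have "(\<Sum>i\<le>n. c q i * x q i ^ k) = (\<Sum>y\<in>e (J q). riesz n q (lagrange (e (J q)) y) * y ^ k)"
      unfolding c_def x_def using sum.reindex_bij_betw[OF bij] by simp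
    ultimately show ?thesis
      using q' e[of "J q"] moments_lagrange[OF e(1,3)[of "J q"], of k q]
      by (auto simp: moment_simplex_def c_def x_def)
  qed
  ultimately show ?thesis using that[of c x] by blast
qed

text \<open>The points with index \<open>Suc n\<close> and \<open>Suc (Suc n)\<close> are reserved for the positions \<open>1\<close> and \<open>d\<close>.\<close>

definition extend_atoms :: "nat \<Rightarrow> real \<Rightarrow> (nat \<Rightarrow> real) \<Rightarrow> real \<Rightarrow> real \<Rightarrow> nat \<Rightarrow> real" where
  "extend_atoms n a f y z = (\<lambda>i. if i \<le> n then a * f i else if i = Suc n then y else z)"

lemma measurable_extend_atoms:
  assumes "f \<in> borel_measurable M"
  shows "(\<lambda>q. extend_atoms n a (f q) y z) \<in> borel_measurable M"
proof (rule measurable_coordinatewise_then_product)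
  have "(\<lambda>q. f q i) \<in> borel_measurable M" for i
    using assms by (rule measurable_product_then_coordinatewise)
  then show "(\<lambda>q. extend_atoms n a (f q) y z i) \<in> borel_measurable M" for i
    by (simp add: extend_atoms_def)
qed

lemma sum_extend_atoms:
  "(\<Sum>i<Suc (Suc (Suc n)). extend_atoms n a c y z i * g (extend_atoms n b x u v i))
    = a * (\<Sum>i\<le>n. c i * g (b * x i)) + y * g u + z * g v"
  by (simp add: extend_atoms_def lessThan_Suc_atMost sum_distrib_left mult_ac)

lemma extend_atoms_in_atom_data:
  assumes "\<And>i. i \<le> n \<Longrightarrow> 0 \<le> a * c i \<and> b * x i \<in> {0..1}" "0 \<le> y" "0 \<le> z" "u \<in> {0..1}" "v \<in> {0..1}"
    and "a * (\<Sum>i\<le>n. c i) + y + z = 1"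
  shows "(extend_atoms n a c y z, extend_atoms n b x u v) \<in> atom_data (Suc (Suc (Suc n)))"
  using assms sum_extend_atoms[of n a c y z "\<lambda>_. 1" b x u v]
  by (auto simp: atom_data_def) (auto simp: extend_atoms_def)

text \<open>The kernel that drives the proof. On \<open>near\<close>, the homothetic image of the moment space close
to \<open>\<gamma>(1)\<close>, it keeps mass \<open>1 - s\<close> at \<open>1\<close> and mass \<open>s * w\<close> at \<open>d\<close>; elsewhere it uses nodes in \<open>D\<close>,
and so avoids \<open>B\<close>, whenever \<open>q\<close> can be represented by them. Outside all the simplices its value is
the point mass at \<open>1\<close>; this concerns only a null set of moment vectors.\<close>

lemma spliced_kernel:
  fixes n :: nat and d s w :: real
  defines "t \<equiv> s * (1 - w)"
  defines "near \<equiv> {q \<in> space (Rn_borel n). homothety n (1 / t) (\<lambda>k. - (1 - s + s * w * d ^ k) / t) q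
      \<in> simplex_union n unit_rationals}"
  assumes B: "B \<in> sets unit_borel" "d \<in> B" and s: "0 < s" "s < 1" and w: "0 < w" "w < 1"
    and D: "countable D" "D \<subseteq> {0..1}" "D \<inter> B = {}"
  obtains F where "F \<in> measurable (Rn_borel n) (borel_of weak_star)"
    "\<And>q. q \<in> space (Rn_borel n) \<Longrightarrow> F q \<in> prob_measures unit_borel"
    "\<And>q. q \<in> near \<union> simplex_union n D \<union> simplex_union n unit_rationals \<Longrightarrow> moment_map n (F q) = q"
    "\<And>q. q \<in> near \<Longrightarrow> s * w \<le> measure (F q) B"
    "\<And>q. q \<in> near \<Longrightarrow> 1 - s \<le> mean (F q)"
    "\<And>q. q \<in> simplex_union n D - near \<Longrightarrow> measure (F q) B = 0"
proof -
  let ?H = "simplex_union n unit_rationals" and ?U = "simplex_union n D" and ?S = "space (Rn_borel n)"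
  let ?N = "Suc (Suc (Suc n))" and ?ext = "extend_atoms n"
  define hom where "hom = homothety n (1 / t) (\<lambda>k. - (1 - s + s * w * d ^ k) / t)"
  have t: "0 < t" using s w by (simp add: t_def)
  have d: "d \<in> {0..1}" using B sets.sets_into_space[OF B(1)] by auto
  have near: "near = {q \<in> ?S. hom q \<in> ?H}" by (simp add: near_def hom_def)
  have [measurable]: "?H \<in> sets (Rn_borel n)" "?U \<in> sets (Rn_borel n)"
    using sets_simplex_union unit_rationals(2) D(1) by auto
  have hom_meas [measurable]: "hom \<in> measurable (Rn_borel n) (Rn_borel n)" by (simp add: hom_def)
  have near_sets [measurable]: "near \<in> sets (Rn_borel n)" unfolding near by measurable
  obtain c1 x1 where m1: "c1 \<in> borel_measurable (Rn_borel n)" "x1 \<in> borel_measurable (Rn_borel n)"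
    and k1: "\<And>q i. q \<in> ?H \<Longrightarrow> i \<le> n \<Longrightarrow> 0 \<le> c1 q i \<and> x1 q i \<in> unit_rationals"
    and mom1: "\<And>q k. q \<in> ?H \<Longrightarrow> k \<le> n \<Longrightarrow> moment q k = (\<Sum>i\<le>n. c1 q i * x1 q i ^ k)"
    using representing_kernel[OF unit_rationals(2), of n] by blast
  obtain c2 x2 where m2: "c2 \<in> borel_measurable (Rn_borel n)" "x2 \<in> borel_measurable (Rn_borel n)"
    and k2: "\<And>q i. q \<in> ?U \<Longrightarrow> i \<le> n \<Longrightarrow> 0 \<le> c2 q i \<and> x2 q i \<in> D"
    and mom2: "\<And>q k. q \<in> ?U \<Longrightarrow> k \<le> n \<Longrightarrow> moment q k = (\<Sum>i\<le>n. c2 q i * x2 q i ^ k)"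
    using representing_kernel[OF D(1), of n] by blast
  have k1: "0 \<le> c1 q i" "x1 q i \<in> {0..1}" if "q \<in> ?H" "i \<le> n" for q i
    using k1[OF that] unit_rationals(3) by auto
  have k2: "0 \<le> c2 q i" "x2 q i \<in> {0..1}" "x2 q i \<notin> B" if "q \<in> ?U" "i \<le> n" for q i
    using k2[OF that] D by auto
  define c where "c = (\<lambda>q. if q \<in> near then ?ext t (c1 (hom q)) (1 - s) (s * w)
      else if q \<in> ?U then ?ext 1 (c2 q) 0 0
      else if q \<in> ?H then ?ext 1 (c1 q) 0 0 else ?ext 0 (c1 q) 1 0)"
  define x where "x = (\<lambda>q. if q \<in> near then ?ext 1 (x1 (hom q)) 1 d
      else if q \<in> ?U then ?ext 1 (x2 q) 1 d
      else if q \<in> ?H then ?ext 1 (x1 q) 1 d else ?ext 0 (x1 q) 1 d)"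
  have c: "c \<in> borel_measurable (Rn_borel n)"
    unfolding c_def
    by (intro measurable_If_set measurable_extend_atoms m1 m2 measurable_compose[OF hom_meas]) auto
  have x: "x \<in> borel_measurable (Rn_borel n)"
    unfolding x_def
    by (intro measurable_If_set measurable_extend_atoms m1 m2 measurable_compose[OF hom_meas]) auto
  have hom: "hom q \<in> ?H" if "q \<in> near" for q using that by (simp add: near)
  have valid: "(c q, x q) \<in> atom_data ?N" for q
  proof -
    consider (near) "q \<in> near" | (U) "q \<notin> near" "q \<in> ?U" | (H) "q \<notin> near" "q \<notin> ?U" "q \<in> ?H"
      | (out) "q \<notin> near" "q \<notin> ?U" "q \<notin> ?H" by blast
    then show ?thesis
    proof cases
      case near
      have "(\<Sum>i\<le>n. c1 (hom q) i) = 1" using mom1[OF hom[OF near], of 0] by (simp add: moment_def)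
      moreover have "t + (1 - s) + s * w = 1" by (simp add: t_def algebra_simps)
      ultimately have "(?ext t (c1 (hom q)) (1 - s) (s * w), ?ext 1 (x1 (hom q)) 1 d) \<in> atom_data ?N"
        using k1[OF hom[OF near]] t s w d by (intro extend_atoms_in_atom_data) auto
      then show ?thesis using near by (simp add: c_def x_def)
    next
      case U
      have "(\<Sum>i\<le>n. c2 q i) = 1" using mom2[OF U(2), of 0] by (simp add: moment_def)
      then have "(?ext 1 (c2 q) 0 0, ?ext 1 (x2 q) 1 d) \<in> atom_data ?N"
        using k2[OF U(2)] d by (intro extend_atoms_in_atom_data) auto
      then show ?thesis using U by (simp add: c_def x_def)
    next
      case H
      have "(\<Sum>i\<le>n. c1 q i) = 1" using mom1[OF H(3), of 0] by (simp add: moment_def)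
      then have "(?ext 1 (c1 q) 0 0, ?ext 1 (x1 q) 1 d) \<in> atom_data ?N"
        using k1[OF H(3)] d by (intro extend_atoms_in_atom_data) auto
      then show ?thesis using H by (simp add: c_def x_def)
    next
      case out
      have "(?ext 0 (c1 q) 1 0, ?ext 0 (x1 q) 1 d) \<in> atom_data ?N"
        using d by (intro extend_atoms_in_atom_data) auto
      then show ?thesis using out by (simp add: c_def x_def)
    qed
  qed
  define F where "F = (\<lambda>q. atomic ?N (c q, x q))"
  have prob: "F q \<in> prob_measures unit_borel" for q
    unfolding F_def using valid by (rule atomic_in_prob_measures)
  have int: "(\<integral>y. f y \<partial>F q) = (\<Sum>i<?N. c q i * f (x q i))" if "f \<in> borel_measurable unit_borel" for f :: "real \<Rightarrow> real" and q
    using integral_atomic[OF valid that] by (simp add: F_def)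
  have powint: "(\<integral>y. y ^ k \<partial>F q) = (\<Sum>i<?N. c q i * x q i ^ k)" for k q
    by (intro int borel_measurable_unit_borel continuous_intros)
  have meas: "measure (F q) B = (\<Sum>i<?N. c q i * indicator B (x q i))" for q
    using measure_atomic[OF valid B(1)] by (simp add: F_def)
  have int_near: "(\<Sum>i<?N. c q i * f (x q i))
      = t * (\<Sum>i\<le>n. c1 (hom q) i * f (x1 (hom q) i)) + (1 - s) * f 1 + s * w * f d" if "q \<in> near" for f q
    using that sum_extend_atoms[of n t "c1 (hom q)" "1 - s" "s * w" f 1 "x1 (hom q)" 1 d]
    by (simp only: c_def x_def if_True mult_1)
  have int_U: "(\<Sum>i<?N. c q i * f (x q i)) = (\<Sum>i\<le>n. c2 q i * f (x2 q i))" if "q \<in> ?U - near" for f q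
    using that sum_extend_atoms[of n 1 "c2 q" 0 0 f 1 "x2 q" 1 d]
    by (simp add: c_def x_def del: sum.lessThan_Suc)
  have int_H: "(\<Sum>i<?N. c q i * f (x q i)) = (\<Sum>i\<le>n. c1 q i * f (x1 q i))" if "q \<in> ?H" "q \<notin> near" "q \<notin> ?U" for f q
    using that sum_extend_atoms[of n 1 "c1 q" 0 0 f 1 "x1 q" 1 d]
    by (simp add: c_def x_def del: sum.lessThan_Suc)
  have space: "near \<union> ?U \<union> ?H \<subseteq> ?S" by (auto simp: near simplex_union_def moment_simplex_def)
  show ?thesis
  proof (rule that[of F])
    show "F \<in> measurable (Rn_borel n) (borel_of weak_star)"
      unfolding F_def using c x valid by (intro measurable_atomic)
    show "F q \<in> prob_measures unit_borel" for q by (rule prob)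
    show "moment_map n (F q) = q" if q: "q \<in> near \<union> ?U \<union> ?H" for q
    proof (rule moment_map_eqI[OF prob])
      show "q \<in> ?S" using q space by blast
      fix k assume k: "k \<in> {1..n}"
      then have k': "k \<le> n" "moment q k = q k" by (auto simp: moment_def)
      consider (near) "q \<in> near" | (U) "q \<in> ?U - near" | (H) "q \<notin> near" "q \<notin> ?U" "q \<in> ?H"
        using q by blast
      then show "(\<integral>y. y ^ k \<partial>F q) = q k"
      proof cases
        case near
        have "moment (hom q) k = 1 / t * q k - (1 - s + s * w * d ^ k) / t"
          using k by (simp add: hom_def homothety_def moment_def diff_divide_distrib add_divide_distrib)
        then have "t * moment (hom q) k = q k - (1 - s + s * w * d ^ k)"
          using t by (simp add: right_diff_distrib)
        then show ?thesis
          unfolding powint int_near[OF near, of "\<lambda>y. y ^ k"]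
          using mom1[OF hom[OF near] k'(1)] by simp
      next
        case U
        then show ?thesis unfolding powint int_U[OF U, of "\<lambda>y. y ^ k"] using mom2[of q k] k' by simp
      next
        case H
        then show ?thesis
          unfolding powint int_H[OF H(3,1,2), of "\<lambda>y. y ^ k"] using mom1[of q k] k' by simp
      qed
    qed
    show "s * w \<le> measure (F q) B" if q: "q \<in> near" for q
    proof -
      have "0 \<le> t * (\<Sum>i\<le>n. c1 (hom q) i * indicator B (x1 (hom q) i))"
        using t k1[OF hom[OF q]] by (intro mult_nonneg_nonneg sum_nonneg) auto
      moreover have "0 \<le> (1 - s) * indicator B 1" using s by simp
      ultimately show ?thesis unfolding meas int_near[OF q, of "indicator B"] using B(2) by simp
    qed
    show "1 - s \<le> mean (F q)" if q: "q \<in> near" for q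
    proof -
      have "mean (F q) = (\<Sum>i<?N. c q i * x q i)" unfolding mean_def using powint[of q 1] by (simp only: power_one_right)
      also have "\<dots> = t * (\<Sum>i\<le>n. c1 (hom q) i * x1 (hom q) i) + (1 - s) * 1 + s * w * d"
        by (rule int_near[OF q, of "\<lambda>y. y"])
      finally have "mean (F q) = t * (\<Sum>i\<le>n. c1 (hom q) i * x1 (hom q) i) + (1 - s) + s * w * d"
        by simp
      moreover have "0 \<le> t * (\<Sum>i\<le>n. c1 (hom q) i * x1 (hom q) i)"
        using t k1[OF hom[OF q]] by (intro mult_nonneg_nonneg sum_nonneg) auto
      moreover have "0 \<le> s * w * d" using s w d by simp
      ultimately show ?thesis by linarith
    qed
    show "measure (F q) B = 0" if q: "q \<in> ?U - near" for q
      unfolding meas int_U[OF q, of "indicator B"] using k2(3)[of q] q by (intro sum.neutral) auto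
  qed
qed

text \<open>The last part reads off volumes relative to the whole moment space; it uses that the
hull of the rational nodes already has full volume.\<close>

lemma uniform_moment_measureD:
  assumes "uniform_moment_measure n \<in> prob_measures (Rn_borel n)"
  shows "prob_space (uniform_moment_measure n)"
    and "sets (uniform_moment_measure n) = sets (Rn_borel n)"
    and "space (uniform_moment_measure n) = space (Rn_borel n)"
    and "0 < \<alpha> \<Longrightarrow> {q \<in> space (Rn_borel n). homothety n \<alpha> v q \<in> moment_hull n unit_rationals} \<subseteq> moment_space n
      \<Longrightarrow> measure (uniform_moment_measure n)
        {q \<in> space (Rn_borel n). homothety n \<alpha> v q \<in> moment_hull n unit_rationals} = 1 / \<alpha> ^ n"
proof -
  let ?Q = "uniform_moment_measure n" and ?M = "moment_space n" and ?H = "moment_hull n unit_rationals"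
  let ?vol = "emeasure (Rn_lborel n)"
  show p: "prob_space ?Q" and s: "sets ?Q = sets (Rn_borel n)"
    using assms by (auto simp: space_prob_algebra)
  then show sp: "space ?Q = space (Rn_borel n)" using sets_eq_imp_space_eq by blast
  interpret prob_space ?Q by (rule p)
  have M: "?M \<in> sets (Rn_lborel n)"
    using p uniform_measure_prob_space_imp_sets unfolding uniform_moment_measure_def by blast
  have Q: "emeasure ?Q A = ?vol (?M \<inter> A) / ?vol ?M" if "A \<in> sets (Rn_borel n)" for A
    unfolding uniform_moment_measure_def using M that by (simp add: sets_Rn_lborel)
  have "?vol ?M / ?vol ?M = 1"
    using Q[of "space (Rn_borel n)"] emeasure_space_1 sets.sets_into_space[OF M]
    by (simp add: sp space_Rn_lborel Int_absorb2)
  then have V: "?vol ?M \<noteq> 0" "?vol ?M \<noteq> \<infinity>" by auto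
  have H: "?H \<in> sets (Rn_borel n)"
    using sets_simplex_union[OF unit_rationals(2)] by (simp add: moment_hull_eq unit_rationals)
  have HM: "?vol ?H = ?vol ?M"
  proof (rule antisym)
    show "?vol ?H \<le> ?vol ?M"
      using M moment_hull_subset_moment_space[OF unit_rationals(3)] by (intro emeasure_mono)
    show "?vol ?M \<le> ?vol ?H" using V by (intro emeasure_moment_space_le_hull) (simp add: less_top)
  qed
  assume \<alpha>: "0 < \<alpha>" and sub: "{q \<in> space (Rn_borel n). homothety n \<alpha> v q \<in> ?H} \<subseteq> ?M"
  let ?P = "{q \<in> space (Rn_borel n). homothety n \<alpha> v q \<in> ?H}"
  have P: "?P \<in> sets (Rn_borel n)" using H by measurable
  have "emeasure ?Q ?P = ?vol ?P / ?vol ?M" using Q[OF P] sub by (simp add: Int_absorb1)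
  then have "ennreal (\<alpha> ^ n) * emeasure ?Q ?P = (ennreal (\<alpha> ^ n) * ?vol ?P) / ?vol ?M"
    by (simp add: ennreal_times_divide)
  also have "\<dots> = 1" using emeasure_homothety_vimage[OF \<alpha> H] HM V
    by (simp add: ennreal_divide_self less_top)
  finally have "ennreal (\<alpha> ^ n * measure ?Q ?P) = ennreal 1"
    using \<alpha> by (simp add: emeasure_eq_measure ennreal_mult)
  then have "\<alpha> ^ n * measure ?Q ?P = 1" using \<alpha> by (subst (asm) ennreal_inj) auto
  then show "measure ?Q ?P = 1 / \<alpha> ^ n" using \<alpha> by (simp add: eq_divide_eq mult.commute)
qed

section \<open>Posterior expectation of the mean\<close>

lemma mean_bounds:
  assumes "\<mu> \<in> prob_measures unit_borel"
  shows "0 \<le> mean \<mu>" "mean \<mu> \<le> 1"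
proof -
  note \<mu> = prob_measures_unit_borelD[OF assms]
  interpret prob_space \<mu> by (rule \<mu>)
  have "(\<lambda>t. t) \<in> borel_measurable \<mu>"
    using borel_measurable_unit_borel[OF continuous_on_id] \<mu>(2) by (simp cong: measurable_cong_sets)
  then have int: "integrable \<mu> (\<lambda>t. t)"
    using \<mu>(3) by (intro integrable_const_bound[where B = 1] AE_I2) auto
  show "0 \<le> mean \<mu>" unfolding mean_def using \<mu>(3) by (intro Bochner_Integration.integral_nonneg) auto
  have "mean \<mu> \<le> (\<integral>t. 1 \<partial>\<mu>)" unfolding mean_def using int \<mu>(3) by (intro integral_mono) auto
  then show "mean \<mu> \<le> 1" by (simp add: prob_space)
qed

lemma measurable_mean: "mean \<in> borel_measurable (borel_of weak_star)"
  unfolding mean_def by (intro measurable_weak_star_integral continuous_on_id)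

lemma upper_value_le_1:
  assumes "PP \<subseteq> priors" "DD \<subseteq> data_maps" "B \<in> sets unit_borel"
  shows "upper_value mean PP B DD \<le> 1"
  unfolding upper_value_def
proof (rule Sup_least, clarify)
  fix \<pi> D assume \<pi>: "\<pi> \<in> PP" and D: "D \<in> DD" and pos: "0 < data_prob \<pi> D B"
  have s: "sets \<pi> = sets (borel_of weak_star)" and p: "prob_space \<pi>"
    using \<pi> assms(1) by (auto simp: space_prob_algebra)
  interpret prob_space \<pi> by (rule p)
  have sp: "space \<pi> = prob_measures unit_borel"
    using sets_eq_imp_space_eq[OF s] by (simp add: space_borel_of topspace_weak_star)
  have "(\<lambda>\<mu>. measure (D \<mu>) B) \<in> borel_measurable (borel_of weak_star)"
    using D assms(2,3) by (auto simp: data_maps_def)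
  then have m: "(\<lambda>\<mu>. measure (D \<mu>) B) \<in> borel_measurable \<pi>" "mean \<in> borel_measurable \<pi>"
    using s measurable_mean by (simp_all cong: measurable_cong_sets)
  have D1: "measure (D \<mu>) B \<le> 1" if "\<mu> \<in> space \<pi>" for \<mu>
  proof -
    have "D \<mu> \<in> prob_measures unit_borel" using D assms(2) that sp by (auto simp: data_maps_def)
    then show ?thesis using prob_space.prob_le_1 prob_measures_unit_borelD(1) by blast
  qed
  have bounds: "0 \<le> mean \<mu>" "mean \<mu> \<le> 1" if "\<mu> \<in> space \<pi>" for \<mu>
    using mean_bounds that sp by auto
  have "(\<integral>\<mu>. mean \<mu> * measure (D \<mu>) B \<partial>\<pi>) \<le> (\<integral>\<mu>. measure (D \<mu>) B \<partial>\<pi>)"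
  proof (rule integral_mono)
    show "integrable \<pi> (\<lambda>\<mu>. measure (D \<mu>) B)"
      using m D1 by (intro integrable_const_bound[where B = 1] AE_I2) auto
    show "integrable \<pi> (\<lambda>\<mu>. mean \<mu> * measure (D \<mu>) B)"
      using m D1 bounds by (intro integrable_const_bound[where B = 1] AE_I2) (auto simp: abs_mult mult_le_one)
    show "mean \<mu> * measure (D \<mu>) B \<le> measure (D \<mu>) B" if "\<mu> \<in> space \<pi>" for \<mu>
      using bounds[OF that] by (simp add: mult_left_le_one_le)
  qed
  then show "ereal (post_expectation \<pi> D mean B) \<le> 1"
    using pos by (simp add: post_expectation_def data_prob_def)
qed

text \<open>Let \<open>g q\<close> be the mass that the kernel gives to \<open>B\<close> and \<open>m q\<close> its mean. On \<open>near\<close> one has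
\<open>(1 - m) * g \<le> s * g\<close>; elsewhere \<open>g\<close> vanishes except outside the simplices with nodes in \<open>D\<close>,
where \<open>(1 - m) * g \<le> 1\<close>. Integrating and dividing by \<open>\<integral>g \<ge> s * w * (s * (1 - w))^n\<close> gives the
bound. The set \<open>D\<close> may be empty: then only the positivity statements have content, and they
settle the case of large \<open>\<delta>\<close>.\<close>

lemma posterior_near_one:
  assumes prob: "uniform_moment_measure n \<in> prob_measures (Rn_borel n)"
    and id: "id_data_map \<in> data_maps"
    and B: "B \<in> sets unit_borel" "d \<in> B" and s: "0 < s" "s < 1" and w: "0 < w" "w < 1"
    and D: "countable D" "D \<subseteq> {0..1}" "D \<inter> B = {}"
  obtains \<pi> where "\<pi> \<in> priors" "distr \<pi> (Rn_borel n) (moment_map n) = uniform_moment_measure n"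
    "0 < data_prob \<pi> id_data_map B" "0 \<le> post_expectation \<pi> id_data_map mean B"
    "1 - s - (1 - measure (uniform_moment_measure n) (simplex_union n D)) / (s * w * (s * (1 - w)) ^ n)
      \<le> post_expectation \<pi> id_data_map mean B"
proof -
  let ?Q = "uniform_moment_measure n" and ?H = "moment_hull n unit_rationals" and ?U = "simplex_union n D"
  note Q = uniform_moment_measureD[OF prob]
  interpret prob_space ?Q by (rule Q)
  define t where "t = s * (1 - w)"
  have t: "0 < t" using s w by (simp add: t_def)
  have HU: "simplex_union n unit_rationals = ?H" by (simp add: moment_hull_eq unit_rationals)
  have H: "?H \<in> sets (Rn_borel n)" and U: "?U \<in> sets (Rn_borel n)"
    using sets_simplex_union[OF unit_rationals(2), of n] sets_simplex_union[OF D(1), of n]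
    by (simp_all only: HU)
  define near where "near = {q \<in> space (Rn_borel n).
    homothety n (1 / t) (\<lambda>k. - (1 - s + s * w * d ^ k) / t) q \<in> ?H}"
  have near: "near \<in> sets (Rn_borel n)" unfolding near_def using H by measurable
  obtain F where F: "F \<in> measurable (Rn_borel n) (borel_of weak_star)"
    and Fp: "\<And>q. q \<in> space (Rn_borel n) \<Longrightarrow> F q \<in> prob_measures unit_borel"
    and Fm: "\<And>q. q \<in> near \<union> ?U \<union> ?H \<Longrightarrow> moment_map n (F q) = q"
    and near1: "\<And>q. q \<in> near \<Longrightarrow> s * w \<le> measure (F q) B"
    and near2: "\<And>q. q \<in> near \<Longrightarrow> 1 - s \<le> mean (F q)"
    and far: "\<And>q. q \<in> ?U - near \<Longrightarrow> measure (F q) B = 0"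
  proof (rule spliced_kernel[OF B s w D, of n, folded t_def, unfolded HU, folded near_def], goal_cases)
    case (1 F)
    show ?case using 1(2-7) by (rule 1(1))
  qed
  have FQ: "F \<in> measurable ?Q (borel_of weak_star)" using F Q(2) by (simp cong: measurable_cong_sets)
  have HM: "?H \<subseteq> moment_space n" by (rule moment_hull_subset_moment_space) (rule unit_rationals)
  have "measure ?Q {q \<in> space (Rn_borel n). homothety n 1 (\<lambda>_. 0) q \<in> ?H} = 1 / 1 ^ n"
  proof (rule Q(4))
    show "{q \<in> space (Rn_borel n). homothety n 1 (\<lambda>_. 0) q \<in> ?H} \<subseteq> moment_space n"
      using HM homothety_one by auto
  qed simp
  also have "{q \<in> space (Rn_borel n). homothety n 1 (\<lambda>_. 0) q \<in> ?H} = ?H"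
  proof -
    have "?H \<subseteq> space (Rn_borel n)" by (auto simp: moment_hull_def)
    then show ?thesis using homothety_one by auto
  qed
  finally have AE_H: "AE q in ?Q. q \<in> ?H" by (intro AE_prob_1) simp
  have "measure ?Q near = 1 / (1 / t) ^ n"
    unfolding near_def
  proof (rule Q(4))
    show "{q \<in> space (Rn_borel n). homothety n (1 / t) (\<lambda>k. - (1 - s + s * w * d ^ k) / t) q \<in> ?H} \<subseteq> moment_space n"
    proof
      fix q assume "q \<in> {q \<in> space (Rn_borel n). homothety n (1 / t) (\<lambda>k. - (1 - s + s * w * d ^ k) / t) q \<in> ?H}"
      then have q: "q \<in> near" "q \<in> space (Rn_borel n)" by (simp_all add: near_def)
      then have "moment_map n (F q) = q" by (intro Fm) simp
      then show "q \<in> moment_space n" using Fp[OF q(2)] unfolding moment_space_def by (metis imageI)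
    qed
  qed (use t in simp)
  then have Qnear: "measure ?Q near = t ^ n" by (simp add: power_one_over)
  define \<pi> where "\<pi> = distr ?Q (borel_of weak_star) F"
  have \<pi>p: "\<pi> \<in> priors"
    unfolding \<pi>_def space_prob_algebra using prob_space_distr[OF FQ] by simp
  have "distr \<pi> (Rn_borel n) (moment_map n) = distr ?Q (Rn_borel n) (moment_map n \<circ> F)"
    unfolding \<pi>_def by (rule distr_distr[OF measurable_moment_map FQ])
  also have "\<dots> = distr ?Q (Rn_borel n) (\<lambda>q. q)"
  proof (rule distr_cong_AE[OF refl refl])
    show "AE q in ?Q. (moment_map n \<circ> F) q = q" using AE_H by eventually_elim (simp add: Fm)
    show "moment_map n \<circ> F \<in> measurable ?Q (Rn_borel n)"
      by (rule measurable_comp[OF FQ measurable_moment_map])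
    show "(\<lambda>q. q) \<in> measurable ?Q (Rn_borel n)" using Q(2) by (intro measurable_ident_sets)
  qed
  also have "\<dots> = ?Q" by (rule distr_id2[OF Q(2)[symmetric]])
  finally have \<pi>m: "distr \<pi> (Rn_borel n) (moment_map n) = ?Q" .
  define g where "g = (\<lambda>q. measure (F q) B)"
  define m where "m = (\<lambda>q. mean (F q))"
  have idm: "(\<lambda>\<mu>. measure (id_data_map \<mu>) B) \<in> borel_measurable (borel_of weak_star)"
    using id B(1) by (auto simp: data_maps_def)
  have idF: "measure (id_data_map (F q)) B = g q" if "q \<in> space ?Q" for q
    using Fp that Q(3) by (simp add: id_data_map_def g_def)
  have P: "data_prob \<pi> id_data_map B = (\<integral>q. g q \<partial>?Q)"
    unfolding data_prob_def \<pi>_def integral_distr[OF FQ idm]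
    by (intro Bochner_Integration.integral_cong idF refl)
  have N: "(\<integral>\<mu>. mean \<mu> * measure (id_data_map \<mu>) B \<partial>\<pi>) = (\<integral>q. m q * g q \<partial>?Q)"
    unfolding \<pi>_def integral_distr[OF FQ borel_measurable_times[OF measurable_mean idm]]
    by (intro Bochner_Integration.integral_cong refl) (simp add: idF m_def)
  have "(\<lambda>q. measure (id_data_map (F q)) B) \<in> borel_measurable ?Q"
    by (rule measurable_compose[OF FQ idm])
  then have gm: "g \<in> borel_measurable ?Q" by (rule measurable_cong[THEN iffD1, rotated]) (rule idF)
  have mm: "m \<in> borel_measurable ?Q"
    unfolding m_def by (rule measurable_compose[OF FQ measurable_mean])
  have g01: "0 \<le> g q" "g q \<le> 1" and m01: "0 \<le> m q" "m q \<le> 1" if "q \<in> space ?Q" for q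
  proof -
    have "F q \<in> prob_measures unit_borel" using Fp that Q(3) by simp
    then show "0 \<le> g q" "g q \<le> 1" "0 \<le> m q" "m q \<le> 1"
      using mean_bounds prob_space.prob_le_1[OF prob_measures_unit_borelD(1)]
      by (auto simp: g_def m_def)
  qed
  have gi: "integrable ?Q g" using gm g01 by (intro integrable_const_bound[where B = 1] AE_I2) auto
  have mgi: "integrable ?Q (\<lambda>q. m q * g q)"
    using gm mm g01 m01 by (intro integrable_const_bound[where B = 1] AE_I2) (auto simp: abs_mult mult_le_one)
  have Us: "?U \<in> sets ?Q" "near \<in> sets ?Q" using U near Q(2) by simp_all
  have "(\<integral>q. s * w * indicator near q \<partial>?Q) \<le> (\<integral>q. g q \<partial>?Q)"
  proof (rule integral_mono)
    show "s * w * indicator near q \<le> g q" if "q \<in> space ?Q" for q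
      using near1[of q] g01[OF that] by (auto simp: indicator_def g_def)
  qed (use Us gi in \<open>auto simp: emeasure_eq_measure\<close>)
  then have low: "s * w * t ^ n \<le> (\<integral>q. g q \<partial>?Q)"
    using Us Qnear sets.sets_into_space[OF Us(2)] by (simp add: Int_absorb2)
  have low0: "0 < s * w * t ^ n" using s w t by simp
  have "(\<integral>q. g q - m q * g q \<partial>?Q) \<le> (\<integral>q. s * g q + indicator (space ?Q - ?U) q \<partial>?Q)"
  proof (rule integral_mono)
    fix q assume q: "q \<in> space ?Q"
    show "g q - m q * g q \<le> s * g q + indicator (space ?Q - ?U) q"
    proof (cases "q \<in> near")
      case True
      then have "(1 - m q) * g q \<le> s * g q"
        using near2[OF True] g01[OF q] by (intro mult_right_mono) (auto simp: m_def)
      moreover have "0 \<le> (indicator (space ?Q - ?U) q :: real)" by simp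
      ultimately show ?thesis unfolding left_diff_distrib mult_1 by linarith
    next
      case False
      have "0 \<le> s * g q" "0 \<le> m q * g q" using s g01[OF q] m01[OF q] by auto
      then show ?thesis using False far[of q] g01[OF q] q by (cases "q \<in> ?U") (auto simp: g_def)
    qed
  qed (use Us gi mgi in \<open>auto simp: emeasure_eq_measure\<close>)
  also have "\<dots> = s * (\<integral>q. g q \<partial>?Q) + measure ?Q (space ?Q - ?U)"
    using gi Us by (subst Bochner_Integration.integral_add) (auto simp: emeasure_eq_measure)
  also have "measure ?Q (space ?Q - ?U) = 1 - measure ?Q ?U" using Us by (simp add: prob_compl)
  finally have up: "(\<integral>q. g q \<partial>?Q) - (\<integral>q. m q * g q \<partial>?Q) \<le> s * (\<integral>q. g q \<partial>?Q) + (1 - measure ?Q ?U)"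
    using gi mgi by simp
  define P0 where "P0 = (\<integral>q. g q \<partial>?Q)"
  have P0: "0 < P0" "s * w * t ^ n \<le> P0" using low low0 by (auto simp: P0_def)
  have post: "post_expectation \<pi> id_data_map mean B = (\<integral>q. m q * g q \<partial>?Q) / P0"
    unfolding post_expectation_def P N P0_def ..
  have "(1 - measure ?Q ?U) / P0 \<le> (1 - measure ?Q ?U) / (s * w * t ^ n)"
    using P0 low0 by (intro divide_left_mono) auto
  moreover have "1 - s - (1 - measure ?Q ?U) / P0 = (P0 - s * P0 - (1 - measure ?Q ?U)) / P0"
    using P0 by (simp add: diff_divide_distrib)
  moreover have "\<dots> \<le> (\<integral>q. m q * g q \<partial>?Q) / P0"
    using up P0 by (intro divide_right_mono) (auto simp: P0_def)
  ultimately have "1 - s - (1 - measure ?Q ?U) / (s * w * t ^ n) \<le> post_expectation \<pi> id_data_map mean B"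
    unfolding post by linarith
  moreover have "0 \<le> post_expectation \<pi> id_data_map mean B"
    unfolding post using P0 g01 m01 by (intro divide_nonneg_pos Bochner_Integration.integral_nonneg) auto
  moreover have "0 < data_prob \<pi> id_data_map B" unfolding P using P0 by (simp add: P0_def)
  ultimately show ?thesis using \<pi>p \<pi>m that unfolding t_def by blast
qed

section \<open>Choice of the constants\<close>

text \<open>This is the inequality behind the constants \<open>4 * e\<close> and \<open>2 * n / e\<close> of the theorem. It is
nearly sharp at \<open>n = 1\<close>, where it says \<open>5 / 2 \<le> e\<close>.\<close>

lemma exponential_bound: "5 * real n * real (Suc n) * exp 1 \<le> (4 * exp 1 ^ 2 :: real) ^ n" if "1 \<le> n"
  using that
proof (induction n rule: dec_induct)
  case base
  have "5 / 2 \<le> (exp 1 :: real)" using exp_lower_Taylor_quadratic[of "1::real"] by simp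
  then have "5 / 2 * exp 1 \<le> (exp 1 :: real) * exp 1" by (intro mult_right_mono) auto
  then show ?case by (simp add: power2_eq_square)
next
  case (step n)
  have e: "3 \<le> (4 * exp 1 ^ 2 :: real)"
  proof -
    have "1 \<le> (exp 1 :: real) ^ 2" by (intro one_le_power) simp
    then show ?thesis by linarith
  qed
  have "5 * real (Suc n) * exp 1 * real (Suc (Suc n)) \<le> 5 * real (Suc n) * exp (1::real) * (3 * real n)"
    using step(1) by (intro mult_left_mono) auto
  then have "5 * real (Suc n) * real (Suc (Suc n)) * exp 1 \<le> 3 * (5 * real n * real (Suc n) * exp (1::real))"
    by (simp only: mult_ac)
  also have "\<dots> \<le> (4 * exp 1 ^ 2) * (4 * exp 1 ^ 2 :: real) ^ n"
    using e step(3) by (intro mult_mono) auto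
  finally show ?case by simp
qed

lemma power_one_minus_inverse_ge: "1 / exp 1 \<le> (1 - 1 / real (Suc n)) ^ n" if "1 \<le> n"
proof -
  have "(1 + 1 / real n) ^ n \<le> exp (1 / real n) ^ n"
    using exp_ge_add_one_self[of "1 / real n"] by (intro power_mono) auto
  also have "\<dots> = exp (1::real)" using that by (simp add: exp_of_nat_mult[symmetric])
  finally have "1 / exp 1 \<le> 1 / (1 + 1 / real n) ^ n" using that by (intro divide_left_mono) (auto simp: add_pos_pos)
  also have "\<dots> = (1 - 1 / real (Suc n)) ^ n"
    using that by (simp add: power_one_over[symmetric] field_simps)
  finally show ?thesis .
qed

text \<open>The choice \<open>w = 1 / (n + 1)\<close> maximises \<open>w * (1 - w)^n\<close>, with maximal value at least
\<open>1 / (e * (n + 1))\<close>.\<close>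

lemma radius_estimates:
  fixes \<epsilon> \<delta> \<eta> :: real
  assumes n: "1 \<le> n" and \<epsilon>: "0 < \<epsilon>" "\<epsilon> < 1" and \<delta>: "0 < \<delta>"
    and eq: "2 * real n * \<delta> / exp 1 = (\<epsilon> / (4 * exp 1)) ^ (2 * n + 1)"
  shows "\<delta> \<le> 1 / 10" "5 * real n * \<delta> \<le> 1"
    and "0 \<le> \<eta> \<Longrightarrow> \<eta> \<le> 5 * real n * 2 ^ Suc n * \<delta> \<Longrightarrow>
      (1 - 1 / (1 + \<eta>) ^ n) / (\<epsilon> / 2 * (1 / real (Suc n)) * (\<epsilon> / 2 * (1 - 1 / real (Suc n))) ^ n) \<le> \<epsilon> / 2"
proof -
  define E where "E = (exp 1 :: real)"
  have E: "2 \<le> E" unfolding E_def using exp_ge_add_one_self[of "1::real"] by simp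
  have eq: "2 * real n * \<delta> = E * (\<epsilon> / (4 * E)) ^ (2 * n + 1)"
    using eq E by (simp add: E_def field_simps)
  have q: "0 \<le> \<epsilon> / (4 * E)" "\<epsilon> / (4 * E) \<le> 1 / (4 * E)" "1 / (4 * E) \<le> 1 / 8"
    using \<epsilon> E by (auto simp: divide_right_mono field_simps)
  have "(\<epsilon> / (4 * E)) ^ (2 * n + 1) \<le> (\<epsilon> / (4 * E)) ^ 3"
    using q n by (intro power_decreasing) auto
  also have "\<dots> \<le> (1 / (4 * E)) ^ 3" using q by (intro power_mono) auto
  finally have "2 * real n * \<delta> \<le> E * (1 / (4 * E)) ^ 3"
    unfolding eq using E by (intro mult_left_mono) auto
  also have "\<dots> = 1 / 4 * (1 / (4 * E)) * (1 / (4 * E))" using E by (simp add: power3_eq_cube field_simps)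
  also have "\<dots> \<le> 1 / 4 * (1 / 8) * (1 / 8)" using q E by (intro mult_mono) auto
  finally have small: "2 * real n * \<delta> \<le> 1 / 256" by simp
  have "\<delta> \<le> real n * \<delta>" using n \<delta> by (simp add: mult_le_cancel_right1)
  then show "\<delta> \<le> 1 / 10" "5 * real n * \<delta> \<le> 1" using small by auto
  assume \<eta>: "0 \<le> \<eta>" "\<eta> \<le> 5 * real n * 2 ^ Suc n * \<delta>"
  define L where "L = (\<epsilon> / 2) ^ Suc n / (real (Suc n) * E)"
  have L: "0 < L" using \<epsilon> E by (simp add: L_def)
  have "L \<le> \<epsilon> / 2 * (1 / real (Suc n)) * (\<epsilon> / 2 * (1 - 1 / real (Suc n))) ^ n"
  proof -
    have "L = \<epsilon> / 2 * (1 / real (Suc n)) * (\<epsilon> / 2) ^ n * (1 / E)" by (simp add: L_def)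
    also have "\<dots> \<le> \<epsilon> / 2 * (1 / real (Suc n)) * (\<epsilon> / 2) ^ n * (1 - 1 / real (Suc n)) ^ n"
      using power_one_minus_inverse_ge[OF n] \<epsilon> unfolding E_def by (intro mult_left_mono) auto
    finally show ?thesis by (simp only: power_mult_distrib mult.assoc)
  qed
  moreover have "1 - 1 / (1 + \<eta>) ^ n \<le> \<epsilon> / 2 * L"
  proof -
    have "1 + real n * (1 / (1 + \<eta>) - 1) \<le> (1 + (1 / (1 + \<eta>) - 1)) ^ n"
      using \<eta>(1) by (intro Bernoulli_inequality) auto
    moreover have "1 - 1 / (1 + \<eta>) \<le> \<eta>" using \<eta>(1) by (simp add: field_simps)
    then have "real n * (1 - 1 / (1 + \<eta>)) \<le> real n * \<eta>" by (intro mult_left_mono) auto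
    ultimately have "1 - 1 / (1 + \<eta>) ^ n \<le> real n * \<eta>" by (simp add: power_one_over algebra_simps)
    also have "\<dots> \<le> real n * (5 * real n * 2 ^ Suc n * \<delta>)" using \<eta>(2) by (intro mult_left_mono) auto
    also have "\<dots> = 5 * real n * 2 ^ n * (2 * real n * \<delta>)" by simp
    also have "\<dots> = 5 * real n * 2 ^ n * E * \<epsilon> ^ (2 * n + 1) / (4 * E) ^ (2 * n + 1)"
      unfolding eq by (simp only: power_divide times_divide_eq_right mult.assoc)
    also have "\<dots> \<le> 5 * real n * 2 ^ n * E * \<epsilon> ^ (n + 2) / (4 * E) ^ (2 * n + 1)"
      using n \<epsilon> E by (intro divide_right_mono mult_left_mono power_decreasing) auto
    also have "\<dots> \<le> \<epsilon> ^ (n + 2) / (2 ^ (n + 2) * (real (Suc n) * E))"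
    proof -
      have "5 * real n * real (Suc n) * E * (4 ^ Suc n * E) \<le> (4 * E ^ 2) ^ n * (4 ^ Suc n * E)"
        using exponential_bound[OF n] E unfolding E_def by (intro mult_right_mono) auto
      moreover have "(4 * E ^ 2) ^ n * (4 ^ Suc n * E) = (4 * E) ^ (2 * n + 1)"
      proof -
        have "(4 * E) ^ (2 * n + 1) = ((4 * E) ^ 2) ^ n * (4 * E)"
          by (simp only: power_add power_mult power_one_right)
        also have "(4 * E) ^ 2 = 4 * (4 * E ^ 2)" by (simp add: power2_eq_square)
        also have "(4 * (4 * E ^ 2)) ^ n = 4 ^ n * (4 * E ^ 2) ^ n" by (rule power_mult_distrib)
        finally show ?thesis by (simp only: power_Suc mult_ac)
      qed
      moreover have "(4 :: real) ^ Suc n = 2 ^ n * 2 ^ (n + 2)"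
      proof -
        have "(4 :: real) ^ n = 2 ^ n * 2 ^ n" using power_mult_distrib[of "2::real" 2 n] by simp
        then show ?thesis by (simp add: power_add)
      qed
      moreover have "5 * real n * real (Suc n) * E * (2 ^ n * 2 ^ (n + 2) * E)
          = 5 * real n * 2 ^ n * E * (2 ^ (n + 2) * (real (Suc n) * E))"
        by (simp only: mult.assoc mult.left_commute mult.commute)
      ultimately have key: "5 * real n * 2 ^ n * E * (2 ^ (n + 2) * (real (Suc n) * E)) \<le> (4 * E) ^ (2 * n + 1)"
        by metis
      have "a * z / c \<le> z / b" if "a * b \<le> c" "0 \<le> z" "0 < b" "0 < c" for a b c z :: real
        using mult_left_mono[OF that(1,2)] that(3,4) by (simp add: field_simps)
      from this[OF key] show ?thesis using \<epsilon> E by simp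
    qed
    also have "\<dots> = \<epsilon> / 2 * L" by (simp add: L_def power_divide)
    finally show ?thesis .
  qed
  moreover have "0 \<le> 1 - 1 / (1 + \<eta>) ^ n" using \<eta>(1) by (simp add: one_le_power)
  ultimately have "(1 - 1 / (1 + \<eta>) ^ n) / (\<epsilon> / 2 * (1 / real (Suc n)) * (\<epsilon> / 2 * (1 - 1 / real (Suc n))) ^ n)
      \<le> (\<epsilon> / 2 * L) / L"
    using L \<epsilon> by (intro frac_le) auto
  then show "(1 - 1 / (1 + \<eta>) ^ n) / (\<epsilon> / 2 * (1 / real (Suc n)) * (\<epsilon> / 2 * (1 - 1 / real (Suc n))) ^ n) \<le> \<epsilon> / 2"
    using L by simp
qed

section \<open>Brittleness of the posterior mean\<close>

theorem theorem3p6: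
  fixes n :: nat
    and QQ :: "(nat \<Rightarrow> real) measure set"
    and DD :: "(real measure \<Rightarrow> real measure) set"
    and d \<delta> :: real
  assumes "n \<ge> 1"
    and "QQ \<subseteq> prob_measures (Rn_borel n)"
    and "uniform_moment_measure n \<in> QQ"
    and "DD \<subseteq> data_maps"
    and "id_data_map \<in> DD"
    and "d \<in> {0..1}"
    and "\<delta> > 0"
  shows "ereal (1 - 4 * exp 1 * (2 * real n * \<delta> / exp 1) powr (1 / (2 * real n + 1)))
           \<le> upper_value mean (moment_priors n QQ) (ball d \<delta> \<inter> {0..1}) DD
       \<and> upper_value mean (moment_priors n QQ) (ball d \<delta> \<inter> {0..1}) DD \<le> 1"
proof -
  let ?B = "ball d \<delta> \<inter> {0..1}" and ?Q = "uniform_moment_measure n"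
  define \<epsilon> where "\<epsilon> = 4 * exp 1 * (2 * real n * \<delta> / exp 1) powr (1 / (2 * real n + 1))"
  have B: "?B \<in> sets unit_borel" unfolding unit_borel_def by (subst sets_restrict_space_iff) auto
  have dB: "d \<in> ?B" using assms(6,7) by simp
  have Q: "?Q \<in> prob_measures (Rn_borel n)" and id: "id_data_map \<in> data_maps"
    using assms(2-5) by auto
  have attained: "ereal x \<le> upper_value mean (moment_priors n QQ) ?B DD"
    if "\<pi> \<in> priors" "distr \<pi> (Rn_borel n) (moment_map n) = ?Q"
      "0 < data_prob \<pi> id_data_map ?B" "x \<le> post_expectation \<pi> id_data_map mean ?B" for x \<pi>
  proof -
    have "ereal (post_expectation \<pi> id_data_map mean ?B) \<le> upper_value mean (moment_priors n QQ) ?B DD"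
      unfolding upper_value_def using that assms(3,5)
      by (intro Sup_upper CollectI exI[of _ \<pi>] exI[of _ id_data_map] conjI refl)
        (auto simp: moment_priors_def)
    then show ?thesis using that(4) by (meson ereal_less_eq(3) order_trans)
  qed
  have base: "0 < 2 * real n * \<delta> / exp 1" using assms(1,7) by simp
  have "0 < (2 * real n * \<delta> / exp 1) powr (1 / (2 * real n + 1))"
    unfolding powr_gt_zero by (rule less_imp_neq[THEN not_sym, OF base])
  then have \<epsilon>0: "0 < \<epsilon>" unfolding \<epsilon>_def by (intro mult_pos_pos) simp_all
  have "ereal (1 - \<epsilon>) \<le> upper_value mean (moment_priors n QQ) ?B DD"
  proof (cases "\<epsilon> < 1")
    \<comment> \<open>the lower bound is not positive, so any prior with positive data probability will do\<close>
    case False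
    obtain \<pi> where "\<pi> \<in> priors" "distr \<pi> (Rn_borel n) (moment_map n) = ?Q"
      "0 < data_prob \<pi> id_data_map ?B" "0 \<le> post_expectation \<pi> id_data_map mean ?B"
      by (rule posterior_near_one[OF Q id B dB, of "1/2" "1/2" "{}"]) auto
    then show ?thesis using False by (intro attained) auto
  next
    case True
    have "((2 * real n * \<delta> / exp 1) powr (1 / (2 * real n + 1))) ^ (2 * n + 1)
        = ((2 * real n * \<delta> / exp 1) powr (1 / (2 * real n + 1))) powr (2 * real n + 1)"
      using base assms(1) by (subst powr_realpow[symmetric]) (auto simp: add.commute)
    also have "\<dots> = 2 * real n * \<delta> / exp 1" using base assms(7) by (simp add: powr_powr)
    finally have eq: "2 * real n * \<delta> / exp 1 = (\<epsilon> / (4 * exp 1)) ^ (2 * n + 1)"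
      by (simp add: \<epsilon>_def)
    note est = radius_estimates[OF assms(1) \<epsilon>0 True assms(7) eq]
    obtain D' \<eta> v where D': "countable D'" "infinite D'" "D' \<subseteq> {0..1}" "D' \<inter> ball d \<delta> = {}"
      and \<eta>: "0 \<le> \<eta>" "\<eta> \<le> 5 * real n * 2 ^ Suc n * \<delta>"
      and sub: "\<And>q. q \<in> space (Rn_borel n) \<Longrightarrow> homothety n (1 + \<eta>) v q \<in> moment_hull n unit_rationals
        \<Longrightarrow> q \<in> moment_hull n D'"
      using moment_hull_avoiding_ball[OF assms(1,6,7) est(1,2)] by metis
    let ?K = "{q \<in> space (Rn_borel n). homothety n (1 + \<eta>) v q \<in> moment_hull n unit_rationals}"
    have K: "?K \<subseteq> simplex_union n D'" using sub moment_hull_eq[OF D'(2)] by auto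
    interpret prob_space ?Q by (rule uniform_moment_measureD[OF Q])
    have "measure ?Q ?K = 1 / (1 + \<eta>) ^ n"
      using sub moment_hull_subset_moment_space[OF D'(3)] \<eta>(1)
      by (intro uniform_moment_measureD(4)[OF Q]) auto
    moreover have "measure ?Q ?K \<le> measure ?Q (simplex_union n D')"
      using K sets_simplex_union[OF D'(1)] uniform_moment_measureD(2)[OF Q] by (intro finite_measure_mono) auto
    ultimately have far: "1 - measure ?Q (simplex_union n D') \<le> 1 - 1 / (1 + \<eta>) ^ n" by simp
    define s w where "s = \<epsilon> / 2" and "w = 1 / real (Suc n)"
    have s: "0 < s" "s < 1" and w: "0 < w" "w < 1" using \<epsilon>0 True assms(1) by (auto simp: s_def w_def)
    have "(1 - measure ?Q (simplex_union n D')) / (s * w * (s * (1 - w)) ^ n)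
        \<le> (1 - 1 / (1 + \<eta>) ^ n) / (s * w * (s * (1 - w)) ^ n)"
      using far s w by (intro divide_right_mono) auto
    also have "\<dots> \<le> \<epsilon> / 2" unfolding s_def w_def by (rule est(3)[OF \<eta>])
    also have "\<epsilon> / 2 = \<epsilon> - s" by (simp add: s_def)
    finally have bound: "1 - \<epsilon> \<le> 1 - s - (1 - measure ?Q (simplex_union n D')) / (s * w * (s * (1 - w)) ^ n)"
      by linarith
    obtain \<pi> where "\<pi> \<in> priors" "distr \<pi> (Rn_borel n) (moment_map n) = ?Q"
      "0 < data_prob \<pi> id_data_map ?B"
      "1 - s - (1 - measure ?Q (simplex_union n D')) / (s * w * (s * (1 - w)) ^ n)
        \<le> post_expectation \<pi> id_data_map mean ?B"
      by (rule posterior_near_one[OF Q id B dB s w D'(1,3)]) (use D'(4) in auto)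
    then show ?thesis using bound by (intro attained) auto
  qed
  moreover have "upper_value mean (moment_priors n QQ) ?B DD \<le> 1"
    using assms(4) B by (intro upper_value_le_1) (auto simp: moment_priors_def)
  ultimately show ?thesis unfolding \<epsilon>_def by simp
qed

end
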